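(* Let $q$ be a prime power and for $n\geq 1$ let $a_n$ be the number of cyclic $n \times n$ matrices over $\mathbf{F}_q$. Then $$1 + \sum_{n \geq 1} \frac{a_n}{\gamma_n}u^n = \prod_{d \geq 1}\left( 1 + \frac{1}{q^d - 1}\,\frac{u^d}{1-(u/q)^d} \right)^{\nu_d}$$ and $$1 + \sum_{n \geq 1} \frac{a_n}{\gamma_n}u^n = \frac{1}{1-u} \prod_{d \geq 1}\left(1 + \frac{u^d}{q^d(q^d-1)} \right) ^{\nu_d} .$$
   Context: $\mathbf{F}_q$ is the field with $q$ elements. $\gamma_n=|\mathrm{GL}_n(q)|=(q^n-1)(q^n-q)\cdots(q^n-q^{n-1})$ is the order of the group of invertible $n\times n$ matrices over $\mathbf{F}_q$. $\nu_d$ is the number of monic irreducible polynomials of degree $d$ over $\mathbf{F}_q$. An $n\times n$ matrix $A$ over $\mathbf{F}_q$ is cyclic if there is a vector $v\in\mathbf{F}_q^n$ such that $\{A^iv : i=0,1,2,\ldots\}$ spans $\mathbf{F}_q^n$ (equivalently, the minimal and characteristic polynomials of $A$ coincide). The identities are of formal power series in $u$. *)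

theory Defs
  imports
    "Jordan_Normal_Form.VS_Connect"
    "HOL-Computational_Algebra.Formal_Power_Series"
    "HOL-Computational_Algebra.Polynomial_Factorial"
    "HOL-Analysis.Infinite_Products"
begin

text \<open>
  The field with \<open>q\<close> elements is a type \<open>'a\<close> of sorts \<open>field\<close> and \<open>finite\<close>
  with \<open>CARD('a) = q\<close>. Since the dimension varies, matrices and vectors have explicit
  carriers \<open>carrier_mat n n\<close> and \<open>carrier_vec n\<close>.
\<close>

definition cyclic_mat :: "nat \<Rightarrow> 'a :: field mat \<Rightarrow> bool" where
  "cyclic_mat n A \<longleftrightarrow>
     A \<in> carrier_mat n n \<and>
     (\<exists>v \<in> carrier_vec n.
        LinearCombinations.module.span class_ring (module_vec TYPE('a) n)
          {(A ^\<^sub>m i) *\<^sub>v v | i. True} = carrier_vec n)"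

definition num_cyclic_mat :: "'a :: {field, finite} itself \<Rightarrow> nat \<Rightarrow> nat" where
  "num_cyclic_mat _ n = card {A :: 'a mat. cyclic_mat n A}"

definition GL_order :: "'a :: {field, finite} itself \<Rightarrow> nat \<Rightarrow> nat" where
  "GL_order _ n = card {A :: 'a mat. A \<in> carrier_mat n n \<and> invertible_mat A}"

definition num_monic_irred :: "'a :: {field, finite} itself \<Rightarrow> nat \<Rightarrow> nat" where
  "num_monic_irred _ d =
     card {p :: 'a poly. Factorial_Ring.irreducible p \<and> lead_coeff p = 1 \<and> degree p = d}"

text \<open>
  In \<open>cyclic_mat\<close>, the library's \<open>span\<close> is used for the \<open>module_vec\<close> structure, whose
  carrier is \<open>carrier_vec n\<close>. The polynomial \<open>irreducible\<close> is the type-class notion, not the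
  one for rings with carriers from HOL-Algebra.

  Identities of formal power series are stated over \<open>rat\<close>. Infinite products
  (\<open>convergent_prod\<close>, \<open>prodinf\<close>) of power series refer to the metric on type \<open>fps\<close>, where
  convergence means that every coefficient is eventually constant.
  They index the factors from 0, so a product over \<open>d \<ge> 1\<close> is written with \<open>d = Suc i\<close>.
\<close>

definition cyclic_series :: "'a :: {field, finite} itself \<Rightarrow> rat fps" where
  "cyclic_series F =
     1 + Abs_fps (\<lambda>n. if n \<ge> 1 then of_nat (num_cyclic_mat F n) / of_nat (GL_order F n) else 0)"

end

theory Submission
  imports Defs
begin

text \<open>
  Write \<open>\<Phi>(f)\<close> for the number of units of \<open>F[X]/(f)\<close>. The heart of the matter is
  \<open>a\<^sub>n / \<gamma>\<^sub>n = \<Sum>\<^sub>f 1 / \<Phi>(f)\<close>, the sum being over the monic polynomials \<open>f\<close> of degree \<open>n\<close>.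
  To see it, count pairs \<open>(A, v)\<close> where \<open>v\<close> is a cyclic vector of \<open>A\<close>. Such a pair satisfies a unique monic relation \<open>f(A) v = 0\<close> of degree
  \<open>n\<close>, and \<open>g \<mapsto> g(A) v\<close> identifies \<open>F[X]/(f)\<close> with \<open>F\<^sup>n\<close> so that multiplication by \<open>X\<close>
  becomes \<open>A\<close>. For fixed \<open>f\<close> such a pair is therefore the same thing as a linear isomorphism
  from \<open>F[X]/(f)\<close> to \<open>F\<^sup>n\<close>, so there are \<open>\<gamma>\<^sub>n\<close> pairs (\<open>bij_betw_krylov_mat\<close>). For fixed \<open>A\<close> the
  other cyclic vectors are the \<open>g(A) v\<close> with \<open>g\<close> a unit modulo \<open>f\<close>, so each \<open>A\<close> is counted
  \<open>\<Phi>(f)\<close> times (\<open>card_cyclic_pairs_fibre\<close>).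

  Since \<open>\<Phi>\<close> is multiplicative (\<open>num_units_mod_mult\<close>), unique factorisation turns the sum over all
  monic \<open>f\<close> into an Euler product (\<open>euler_product\<close>), and \<open>\<Phi>(p\<^sup>k) = q\<^bsup>d(k-1)\<^esup>(q\<^sup>d - 1)\<close> for \<open>p\<close>
  irreducible of degree \<open>d\<close> makes its factors geometric series. This is the first identity.

  The same Euler product with the weight \<open>q\<^bsup>-deg f\<^esup>\<close> says that \<open>1 / (1 - u)\<close> is the product
  over \<open>d \<ge> 1\<close> of the series \<open>(1 - (u/q)\<^sup>d)\<^sup>-\<^sup>1\<close>, each raised to the power
  \<open>\<nu>\<^sub>d\<close>, and multiplying the factor for \<open>d\<close> in the first identity by \<open>1 - (u/q)\<^sup>d\<close> gives the
  factor in the second. Coefficients of all partial products stabilise, so the argument never has to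
  multiply infinite products.
\<close>

(* From here on, $ denotes the entries of a Matrix.vec only. *)
unbundle no vec_syntax

section \<open>Coprimality in Euclidean rings\<close>

text \<open>Division with remainder shows that a nonzero combination of \<open>a\<close> and \<open>b\<close> of least
  Euclidean size divides all combinations, in particular \<open>a\<close> and \<open>b\<close>, and is therefore a unit.\<close>

lemma coprime_bezout:
  fixes a b :: "'a :: euclidean_ring"
  assumes "coprime a b"
  shows "\<exists>x y. x * a + y * b = 1"
proof -
  define I where "I = {x * a + y * b | x y. True}"
  have comb: "s - t * r \<in> I" if sr: "s \<in> I" "r \<in> I" for s t r
  proof -
    obtain x y x' y' where "s = x * a + y * b" "r = x' * a + y' * b"
      using sr unfolding I_def by blast
    then have "s - t * r = (x - t * x') * a + (y - t * y') * b" by (simp add: algebra_simps)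
    then show ?thesis by (auto simp: I_def)
  qed
  have "a \<in> I" unfolding I_def by (rule CollectI, intro exI[of _ 1] exI[of _ 0]) simp
  have "b \<in> I" unfolding I_def by (rule CollectI, intro exI[of _ 0] exI[of _ 1]) simp
  have "a \<noteq> 0 \<or> b \<noteq> 0" using assms by auto
  then have "\<exists>r. r \<in> I \<and> r \<noteq> 0" using \<open>a \<in> I\<close> \<open>b \<in> I\<close> by blast
  then obtain r where r: "r \<in> I" "r \<noteq> 0"
    and least: "\<And>s. s \<in> I \<Longrightarrow> s \<noteq> 0 \<Longrightarrow> euclidean_size r \<le> euclidean_size s"
    using exists_least_iff[of "\<lambda>k. \<exists>r. r \<in> I \<and> r \<noteq> 0 \<and> euclidean_size r = k"]
    by (metis (mono_tags, lifting) not_less)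
  have dvd: "r dvd s" if "s \<in> I" for s
  proof -
    have "s mod r = s - s div r * r" by (simp add: minus_div_mult_eq_mod)
    then have "s mod r \<in> I" using comb[OF that r(1)] by metis
    then have "s mod r = 0" using least[of "s mod r"] mod_size_less[OF r(2), of s] by linarith
    then show ?thesis by (simp add: mod_eq_0_iff_dvd)
  qed
  have "is_unit r"
    using assms dvd \<open>a \<in> I\<close> \<open>b \<in> I\<close> coprime_common_divisor by blast
  then obtain t where "1 = r * t" by blast
  moreover obtain x y where "r = x * a + y * b" using r by (auto simp: I_def)
  ultimately have "t * x * a + t * y * b = 1" by (simp add: algebra_simps)
  then show ?thesis by blast
qed

lemma bezout_coprime:
  fixes a b :: "'a :: algebraic_semidom"
  assumes "x * a + y * b = 1"
  shows "coprime a b"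
  by (rule coprimeI) (metis assms dvd_add dvd_mult)

lemma coprime_mult_right_bezout_iff:
  fixes a b c :: "'a :: euclidean_ring"
  shows "coprime a (b * c) \<longleftrightarrow> coprime a b \<and> coprime a c"
proof safe
  assume "coprime a b" "coprime a c"
  then obtain x y x' y' where "x * a + y * b = 1" "x' * a + y' * c = 1"
    using coprime_bezout by metis
  then have "(x * a + y * b) * (x' * a + y' * c) = 1" by simp
  then have "(x * a * x' + x * y' * c + y * b * x') * a + (y * y') * (b * c) = 1"
    by (simp add: algebra_simps)
  then show "coprime a (b * c)" by (rule bezout_coprime)
qed (metis coprime_divisors dvd_refl dvd_triv_left dvd_triv_right)+

lemma coprime_power_right_bezout:
  fixes a b :: "'a :: euclidean_ring"
  assumes "coprime a b"
  shows "coprime a (b ^ k)"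
  using assms by (induction k) (auto simp: coprime_mult_right_bezout_iff)

lemma coprime_dvd_cancel:
  fixes a b c :: "'a :: euclidean_ring"
  assumes "coprime a b" "a dvd b * c"
  shows "a dvd c"
proof -
  obtain x y where "x * a + y * b = 1" using coprime_bezout[OF assms(1)] by blast
  then have "(x * a + y * b) * c = c" by simp
  then have "c = a * (x * c) + y * (b * c)" by (simp add: algebra_simps)
  then show ?thesis using assms(2) by (metis dvd_add dvd_mult dvd_triv_left)
qed

lemma coprime_dvd_mult:
  fixes a b c :: "'a :: euclidean_ring"
  assumes "coprime a b" "a dvd c" "b dvd c"
  shows "a * b dvd c"
  by (metis assms coprime_dvd_cancel dvd_def mult.commute mult_dvd_mono dvd_refl)

lemma irreducible_coprime_iff:
  fixes p a :: "'a :: algebraic_semidom"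
  assumes "Factorial_Ring.irreducible p"
  shows "coprime p a \<longleftrightarrow> \<not> p dvd a"
proof
  assume "coprime p a"
  then show "\<not> p dvd a"
    using assms by (meson coprime_common_divisor dvd_refl irreducible_not_unit)
next
  assume "\<not> p dvd a"
  show "coprime p a"
  proof (rule coprimeI)
    fix c assume c: "c dvd p" "c dvd a"
    then obtain d where "p = c * d" by blast
    then consider "is_unit c" | "is_unit d" using irreducibleD[OF assms] by blast
    then show "is_unit c"
    proof cases
      case 2
      then have "p dvd c" using \<open>p = c * d\<close> by simp
      then show ?thesis using c \<open>\<not> p dvd a\<close> dvd_trans by blast
    qed
  qed
qed

section \<open>Residues and units modulo a polynomial\<close>

text \<open>Bounding coefficients rather than the degree makes \<open>polys_below 0\<close> the set \<open>{0}\<close>, so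
  that \<open>polys_below (degree f)\<close> is a system of residues modulo \<open>f\<close> also for constant \<open>f\<close>.\<close>

definition polys_below :: "nat \<Rightarrow> 'a :: zero poly set" where
  "polys_below n = {f. \<forall>i\<ge>n. coeff f i = 0}"

lemma polys_below_0: "polys_below 0 = {0 :: 'a :: zero poly}"
  by (auto simp: polys_below_def poly_eq_iff)

lemma polys_below_iff: "f \<in> polys_below n \<longleftrightarrow> f = 0 \<or> degree f < n"
  unfolding polys_below_def
  by (auto simp: coeff_eq_0 intro: leI)

lemma polys_below_Suc:
  "polys_below (Suc n) = (\<lambda>(a, f). pCons a f) ` (UNIV \<times> polys_below n)" (is "?L = ?R")
proof
  show "?L \<subseteq> ?R"
  proof
    fix f :: "'a poly" assume f: "f \<in> ?L"
    obtain a g where "f = pCons a g" by (cases f)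
    moreover have "g \<in> polys_below n"
      using f unfolding calculation polys_below_def
      by (auto simp: coeff_pCons)
    ultimately show "f \<in> ?R" by force
  qed
qed (auto simp: polys_below_def coeff_pCons split: nat.splits)

lemma finite_polys_below: "finite (polys_below n :: 'a :: {zero, finite} poly set)"
  by (induction n) (simp_all add: polys_below_0 polys_below_Suc)

lemma card_polys_below: "card (polys_below n :: 'a :: {zero, finite} poly set) = CARD('a) ^ n"
proof (induction n)
  case (Suc n)
  have "inj_on (\<lambda>(a, f). pCons a f) (UNIV \<times> polys_below n :: ('a \<times> 'a poly) set)"
    by (auto simp: inj_on_def)
  then show ?case by (simp add: polys_below_Suc card_image card_cartesian_product Suc)
qed (simp add: polys_below_0)

lemma card_finite_field_gt_1: "CARD('a :: {field, finite}) > 1"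
proof -
  have "card {0, 1 :: 'a} \<le> CARD('a)" by (rule card_mono) auto
  then show ?thesis by simp
qed

lemma polys_below_diff:
  fixes f g :: "'a :: ab_group_add poly"
  shows "f \<in> polys_below n \<Longrightarrow> g \<in> polys_below n \<Longrightarrow> f - g \<in> polys_below n"
  by (simp add: polys_below_def)

lemma mod_in_polys_below:
  fixes f g :: "'a :: field poly"
  assumes "g \<noteq> 0"
  shows "f mod g \<in> polys_below (degree g)"
  using degree_mod_less[OF assms, of f] by (auto simp: polys_below_iff)

lemma mod_polys_below:
  fixes f g :: "'a :: field poly"
  assumes "f \<in> polys_below (degree g)"
  shows "f mod g = f"
  using assms by (auto simp: polys_below_iff mod_poly_less)

lemma dvd_polys_below_eq_0:
  fixes f g :: "'a :: field poly"
  assumes "f \<in> polys_below (degree g)" "g dvd f"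
  shows "f = 0"
  using assms by (auto simp: polys_below_iff dest: dvd_imp_degree_le)

definition unit_residues :: "'a :: field poly \<Rightarrow> 'a poly set" where
  "unit_residues f = {r \<in> polys_below (degree f). coprime r f}"

definition num_units_mod :: "'a :: field poly \<Rightarrow> nat" where
  "num_units_mod f = card (unit_residues f)"

lemma finite_unit_residues: "finite (unit_residues (f :: 'a :: {field, finite} poly))"
  by (simp add: unit_residues_def finite_polys_below)

lemma num_units_mod_pos:
  fixes f :: "'a :: {field, finite} poly"
  assumes "f \<noteq> 0"
  shows "num_units_mod f > 0"
proof -
  have "1 mod f \<in> unit_residues f"
    using assms by (simp add: unit_residues_def mod_in_polys_below)
  then show ?thesis unfolding num_units_mod_def using finite_unit_residues card_gt_0_iff by blast
qed

text \<open>The Chinese remainder theorem: reduction modulo both factors is injective on residues, and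
  the two finite sets have equal size, so it is a bijection; coprimality to the product is
  coprimality to both factors.\<close>

lemma num_units_mod_mult:
  fixes f g :: "'a :: {field, finite} poly"
  assumes "coprime f g" "f \<noteq> 0" "g \<noteq> 0"
  shows "num_units_mod (f * g) = num_units_mod f * num_units_mod g"
proof -
  let ?h = "\<lambda>r. (r mod f, r mod g)"
  let ?D = "polys_below (degree (f * g)) :: 'a poly set"
  let ?C = "polys_below (degree f) \<times> polys_below (degree g) :: ('a poly \<times> 'a poly) set"
  have inj: "inj_on ?h ?D"
  proof (rule inj_onI)
    fix r s assume r: "r \<in> ?D" and s: "s \<in> ?D" and "?h r = ?h s"
    then have "f dvd r - s" "g dvd r - s" by (simp_all add: mod_eq_dvd_iff)
    then have "f * g dvd r - s" by (rule coprime_dvd_mult[OF assms(1)])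
    then show "r = s"
      using dvd_polys_below_eq_0[OF polys_below_diff[OF r s]] by simp
  qed
  have "?h ` ?D \<subseteq> ?C" using assms by (auto simp: mod_in_polys_below)
  moreover have "card ?D = card ?C"
    using assms by (simp add: card_cartesian_product card_polys_below degree_mult_eq power_add)
  ultimately have onto: "?h ` ?D = ?C"
    by (simp add: card_image[OF inj] card_subset_eq finite_polys_below)
  have unit: "coprime r (f * g) \<longleftrightarrow> coprime (r mod f) f \<and> coprime (r mod g) g" for r
    using assms by (simp add: coprime_mult_right_bezout_iff)
  have "?h ` unit_residues (f * g) = unit_residues f \<times> unit_residues g"
  proof
    show "?h ` unit_residues (f * g) \<subseteq> unit_residues f \<times> unit_residues g"
    proof
      fix x assume "x \<in> ?h ` unit_residues (f * g)"
      then obtain r where "x = ?h r" "coprime r (f * g)" by (auto simp: unit_residues_def)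
      then show "x \<in> unit_residues f \<times> unit_residues g"
        using assms(2,3) unit[of r] by (simp add: unit_residues_def mod_in_polys_below)
    qed
    show "unit_residues f \<times> unit_residues g \<subseteq> ?h ` unit_residues (f * g)"
    proof
      fix x assume x: "x \<in> unit_residues f \<times> unit_residues g"
      then have "x \<in> ?h ` ?D" unfolding onto by (auto simp: unit_residues_def)
      then obtain r where "r \<in> ?D" "x = ?h r" by blast
      then show "x \<in> ?h ` unit_residues (f * g)"
        using x unit[of r] by (auto simp: unit_residues_def)
    qed
  qed
  moreover have "inj_on ?h (unit_residues (f * g))"
    using inj by (rule inj_on_subset) (auto simp: unit_residues_def)
  ultimately have "card (unit_residues (f * g)) = card (unit_residues f \<times> unit_residues g)"
    using card_image by fastforce
  then show ?thesis by (simp add: num_units_mod_def card_cartesian_product)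
qed

text \<open>Modulo a power of \<open>p\<close> the non-units are the multiples of \<open>p\<close>.\<close>

lemma num_units_mod_prime_power:
  fixes p :: "'a :: {field, finite} poly"
  assumes "Factorial_Ring.irreducible p" "d = degree p"
  shows "num_units_mod (p ^ Suc k) + CARD('a) ^ (d * k) = CARD('a) ^ (d * Suc k)"
proof -
  have p: "p \<noteq> 0" using assms by auto
  let ?D = "polys_below (degree (p ^ Suc k)) :: 'a poly set"
  have unit: "coprime r (p ^ Suc k) \<longleftrightarrow> \<not> p dvd r" for r
  proof -
    have "coprime r (p ^ Suc k) \<longleftrightarrow> coprime r p"
      using coprime_power_right_bezout[of r p k] by (auto simp: coprime_mult_right_bezout_iff)
    then show ?thesis using irreducible_coprime_iff[OF assms(1), of r] by (simp add: coprime_commute)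
  qed
  let ?N = "(\<lambda>g. p * g) ` polys_below (d * k)"
  have deg: "degree (p ^ Suc k) = d * Suc k"
    using p assms by (simp add: degree_power_eq degree_mult_eq)
  have N: "{r \<in> ?D. p dvd r} = ?N"
  proof (intro equalityI subsetI)
    fix r assume "r \<in> {r \<in> ?D. p dvd r}"
    then obtain g where "r = p * g" "p * g \<in> ?D" by (auto elim: dvdE)
    moreover have "g \<in> polys_below (d * k)"
      using calculation p unfolding polys_below_iff deg
      by (cases "g = 0") (auto simp: degree_mult_eq assms(2))
    ultimately show "r \<in> ?N" by blast
  next
    fix r assume "r \<in> ?N"
    then obtain g where "r = p * g" "g \<in> polys_below (d * k)" by auto
    then show "r \<in> {r \<in> ?D. p dvd r}"
      using p unfolding polys_below_iff deg by (cases "g = 0") (auto simp: degree_mult_eq assms(2))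
  qed
  have "card ?N = CARD('a) ^ (d * k)"
    using p by (subst card_image) (auto simp: inj_on_def card_polys_below)
  moreover have "?D = unit_residues (p ^ Suc k) \<union> ?N" "unit_residues (p ^ Suc k) \<inter> ?N = {}"
    unfolding N[symmetric] unit_residues_def using unit by auto
  then have "card ?D = num_units_mod (p ^ Suc k) + card ?N"
    unfolding num_units_mod_def
    by (metis card_Un_disjoint finite_polys_below finite_unit_residues finite_imageI)
  ultimately show ?thesis unfolding card_polys_below deg by simp
qed

section \<open>Euler products over monic polynomials\<close>

definition monic_polys :: "nat \<Rightarrow> 'a :: field poly set" where
  "monic_polys n = {f. lead_coeff f = 1 \<and> degree f = n}"

definition monic_irreducibles :: "nat \<Rightarrow> 'a :: field poly set" where
  "monic_irreducibles d = {p. Factorial_Ring.irreducible p \<and> lead_coeff p = 1 \<and> degree p = d}"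

text \<open>The analogue of smooth numbers: the polynomials over which the partial Euler product over
  \<open>P\<close> sums.\<close>

definition smooth_polys :: "'a :: field poly set \<Rightarrow> nat \<Rightarrow> 'a poly set" where
  "smooth_polys P n =
     {f \<in> monic_polys n. \<forall>p d. p \<in> monic_irreducibles d \<and> p dvd f \<longrightarrow> p \<in> P}"

lemma monic_polys_eq_image: "monic_polys n = (\<lambda>r. monom 1 n + r) ` polys_below n"
proof (intro equalityI subsetI)
  fix f :: "'a poly" assume f: "f \<in> monic_polys n"
  have "f - monom 1 n \<in> polys_below n"
    using f by (auto simp: polys_below_def monic_polys_def coeff_eq_0)
  then show "f \<in> (\<lambda>r. monom 1 n + r) ` polys_below n" by (rule rev_image_eqI) simp
next
  fix f :: "'a poly" assume "f \<in> (\<lambda>r. monom 1 n + r) ` polys_below n"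
  then obtain r where r: "f = monom 1 n + r" "\<forall>i\<ge>n. coeff r i = 0" by (auto simp: polys_below_def)
  then have "coeff f n = 1" "\<And>i. i > n \<Longrightarrow> coeff f i = 0" by auto
  moreover from this have "degree f = n"
    by (metis degree_le le_antisym le_degree zero_neq_one)
  ultimately show "f \<in> monic_polys n" by (simp add: monic_polys_def)
qed

lemma finite_monic_polys: "finite (monic_polys n :: 'a :: {field, finite} poly set)"
  by (simp add: monic_polys_eq_image finite_polys_below)

lemma card_monic_polys: "card (monic_polys n :: 'a :: {field, finite} poly set) = CARD('a) ^ n"
  unfolding monic_polys_eq_image by (subst card_image) (auto simp: card_polys_below)

lemma finite_monic_irreducibles:
  "finite (monic_irreducibles d :: 'a :: {field, finite} poly set)"
  by (rule finite_subset[OF _ finite_monic_polys[of d]])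
    (auto simp: monic_irreducibles_def monic_polys_def)

lemma finite_smooth_polys: "finite (smooth_polys P n :: 'a :: {field, finite} poly set)"
  by (rule finite_subset[OF _ finite_monic_polys[of n]]) (auto simp: smooth_polys_def)

lemma monic_polys_0: "monic_polys 0 = {1 :: 'a :: field poly}"
  by (auto simp: monic_polys_def elim!: degree_eq_zeroE)

lemma monic_polys_nonzero: "f \<in> monic_polys n \<Longrightarrow> f \<noteq> 0"
  by (auto simp: monic_polys_def)

lemma monic_polys_mult: "f \<in> monic_polys m \<Longrightarrow> g \<in> monic_polys n \<Longrightarrow> f * g \<in> monic_polys (m + n)"
  by (auto simp: monic_polys_def lead_coeff_mult intro!: degree_mult_eq)

lemma monic_polys_power: "f \<in> monic_polys m \<Longrightarrow> f ^ k \<in> monic_polys (m * k)"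
  using monic_polys_mult[of f m] by (induction k) (auto simp: monic_polys_0)

lemma monic_polys_mult_cancel:
  assumes "f * g \<in> monic_polys n" "f \<in> monic_polys m"
  shows "m \<le> n" "g \<in> monic_polys (n - m)"
proof -
  have "f \<noteq> 0" "g \<noteq> 0" using assms monic_polys_nonzero by fastforce+
  then have "m + degree g = n" using assms by (simp add: monic_polys_def degree_mult_eq)
  moreover have "lead_coeff f * lead_coeff g = 1" "lead_coeff f = 1"
    using assms unfolding monic_polys_def lead_coeff_mult[symmetric] by blast+
  then have "lead_coeff g = 1" by simp
  ultimately show "m \<le> n" "g \<in> monic_polys (n - m)" by (auto simp: monic_polys_def)
qed

lemma monic_irreducibles_monic: "p \<in> monic_irreducibles d \<Longrightarrow> p \<in> monic_polys d"
  by (auto simp: monic_irreducibles_def monic_polys_def)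

lemma monic_irreducibles_degree_pos:
  assumes "p \<in> monic_irreducibles d"
  shows "d > 0"
proof (rule ccontr)
  assume "\<not> d > 0"
  then have "p = 1" using monic_irreducibles_monic[OF assms] by (simp add: monic_polys_0)
  then show False using assms by (simp add: monic_irreducibles_def)
qed

lemma monic_irreducible_dvd_imp_eq:
  assumes "p \<in> monic_irreducibles d" "r \<in> monic_irreducibles e" "r dvd p"
  shows "r = p"
proof -
  obtain s where s: "p = r * s" using assms(3) by blast
  moreover have "\<not> is_unit r" using assms(2) by (simp add: monic_irreducibles_def irreducible_not_unit)
  ultimately have "is_unit s"
    using assms(1) irreducibleD unfolding monic_irreducibles_def by blast
  then have "degree s = 0" using is_unit_iff_degree[of s] by (cases "s = 0") auto
  moreover have "s \<in> monic_polys (d - e)"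
    using monic_polys_mult_cancel(2)[of r s d e] monic_irreducibles_monic assms s by metis
  ultimately have "s = 1" using monic_polys_0 unfolding monic_polys_def by blast
  then show ?thesis using s by simp
qed

lemma monic_irreducibles_dvd_mult:
  assumes "p \<in> monic_irreducibles d" "p dvd f * g"
  shows "p dvd f \<or> p dvd g"
  using assms coprime_dvd_cancel[of p f g] irreducible_coprime_iff[of p f]
  by (auto simp: monic_irreducibles_def)

lemma monic_irreducibles_dvd_power:
  assumes "p \<in> monic_irreducibles d" "p dvd f ^ k"
  shows "p dvd f"
  using assms(2)
proof (induction k)
  case 0
  then show ?case using assms(1) irreducible_not_unit by (auto simp: monic_irreducibles_def)
qed (use monic_irreducibles_dvd_mult[OF assms(1)] in auto)

lemma exists_monic_irreducible_factor:
  fixes f :: "'a :: field poly"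
  assumes "f \<in> monic_polys n" "n > 0"
  shows "\<exists>d p. p \<in> monic_irreducibles d \<and> p dvd f \<and> d \<le> n"
  using assms
proof (induction n arbitrary: f rule: less_induct)
  case (less n)
  have f: "f \<noteq> 0" using less.prems monic_polys_nonzero by blast
  then have "\<not> is_unit f" using less.prems by (auto simp: monic_polys_def is_unit_iff_degree)
  note f = f this
  show ?case
  proof (cases "Factorial_Ring.irreducible f")
    case True
    then show ?thesis using less.prems(1) by (auto simp: monic_irreducibles_def monic_polys_def)
  next
    case False
    then obtain g h where gh: "f = g * h" "\<not> is_unit g" "\<not> is_unit h"
      using f unfolding Factorial_Ring.irreducible_def by blast
    have nz: "g \<noteq> 0" "h \<noteq> 0" using gh f by auto
    have "degree g + degree h = n" "degree g > 0" "degree h > 0"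
      using gh nz less.prems(1) is_unit_iff_degree
      by (auto simp: monic_polys_def degree_mult_eq)
    \<comment> \<open>Normalise the proper factor \<open>g\<close> to a monic one.\<close>
    moreover define g' where "g' = Polynomial.smult (inverse (lead_coeff g)) g"
    ultimately have g': "g' \<in> monic_polys (degree g)" "g' dvd f" "degree g < n" "degree g > 0"
      using nz gh by (auto simp: monic_polys_def smult_dvd_iff)
    then show ?thesis using less.IH[of "degree g" g'] by (meson dvd_trans less_imp_le order.trans)
  qed
qed

lemma smooth_polys_empty: "smooth_polys {} n = (if n = 0 then {1 :: 'a :: field poly} else {})"
proof (cases "n = 0")
  case True
  then show ?thesis
    by (auto simp: smooth_polys_def monic_polys_0 monic_irreducibles_def irreducible_not_unit)
next
  case False
  have "f \<notin> smooth_polys {} n" for f :: "'a poly"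
    using exists_monic_irreducible_factor[of f n] False unfolding smooth_polys_def by blast
  then show ?thesis using False by auto
qed

text \<open>This holds since a polynomial of degree \<open>n\<close> has no factor of larger degree.\<close>

lemma smooth_polys_all:
  assumes "\<And>d. d \<le> n \<Longrightarrow> monic_irreducibles d \<subseteq> P"
  shows "smooth_polys P n = monic_polys n"
proof -
  have "p \<in> P" if "f \<in> monic_polys n" "p \<in> monic_irreducibles d" "p dvd f" for f p d
  proof -
    have "d \<le> n" using that monic_irreducibles_monic monic_polys_mult_cancel(1) by (metis dvdE)
    then show ?thesis using assms that by blast
  qed
  then show ?thesis by (auto simp: smooth_polys_def)
qed

text \<open>Splitting off the full power of \<open>p\<close> from a polynomial is unique factorisation in the form
  needed to append the Euler factor of \<open>p\<close>.\<close>

lemma smooth_polys_insert: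
  fixes p :: "'a :: field poly"
  assumes p: "p \<in> monic_irreducibles d" and "p \<notin> P"
  shows "bij_betw (\<lambda>(k, f). p ^ k * f) (SIGMA k:{k. d * k \<le> n}. smooth_polys P (n - d * k))
           (smooth_polys (insert p P) n)"
proof -
  have pm: "p \<in> monic_polys d" by (rule monic_irreducibles_monic[OF p])
  then have nz: "p \<noteq> 0" by (rule monic_polys_nonzero)
  have ndvd: "\<not> p dvd f" if "f \<in> smooth_polys P m" for f m
    using that p \<open>p \<notin> P\<close> by (auto simp: smooth_polys_def)
  have le: "k \<le> l" if "p ^ k * f = p ^ l * g" "f \<in> smooth_polys P m" "g \<in> smooth_polys P m'"
    for k l f g m m'
  proof (rule ccontr)
    assume "\<not> k \<le> l"
    then have "k = l + Suc (k - Suc l)" by simp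
    then obtain j where "k = l + Suc j" ..
    then have "p ^ l * (p ^ Suc j * f) = p ^ l * g" using that(1) by (simp add: power_add mult.assoc)
    then have "g = p ^ Suc j * f" using nz by simp
    then show False using ndvd[OF that(3)] by simp
  qed
  show ?thesis
    unfolding bij_betw_def
  proof (intro conjI)
    show "inj_on (\<lambda>(k, f). p ^ k * f) (SIGMA k:{k. d * k \<le> n}. smooth_polys P (n - d * k))"
    proof (rule inj_onI, clarify)
      fix k l f g
      assume f: "f \<in> smooth_polys P (n - d * k)" and g: "g \<in> smooth_polys P (n - d * l)"
        and eq: "p ^ k * f = p ^ l * g"
      have "k = l" using le[OF eq f g] le[OF eq[symmetric] g f] by simp
      then show "k = l \<and> f = g" using eq nz by simp
    qed
    show "(\<lambda>(k, f). p ^ k * f) ` (SIGMA k:{k. d * k \<le> n}. smooth_polys P (n - d * k))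
            = smooth_polys (insert p P) n"
    proof (intro equalityI subsetI)
      fix h assume "h \<in> (\<lambda>(k, f). p ^ k * f) ` (SIGMA k:{k. d * k \<le> n}. smooth_polys P (n - d * k))"
      then obtain k f where k: "d * k \<le> n" and f: "f \<in> smooth_polys P (n - d * k)" and h: "h = p ^ k * f"
        by auto
      have "h \<in> monic_polys n"
        using monic_polys_mult[OF monic_polys_power[OF pm, of k], of f "n - d * k"] f k
        by (simp add: h smooth_polys_def)
      moreover have "r \<in> insert p P" if "r \<in> monic_irreducibles e" "r dvd h" for r e
      proof -
        have "r dvd p \<or> r dvd f"
          using monic_irreducibles_dvd_mult[OF that(1), of "p ^ k" f]
            monic_irreducibles_dvd_power[OF that(1), of p k] that(2) unfolding h by blast
        then show ?thesis
          using monic_irreducible_dvd_imp_eq[OF p that(1)] f that(1) by (auto simp: smooth_polys_def)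
      qed
      ultimately show "h \<in> smooth_polys (insert p P) n" by (auto simp: smooth_polys_def)
    next
      fix h assume h: "h \<in> smooth_polys (insert p P) n"
      then have hm: "h \<in> monic_polys n" by (simp add: smooth_polys_def)
      define k where "k = (GREATEST k. p ^ k dvd h)"
      have bound: "j \<le> n" if "p ^ j dvd h" for j
      proof -
        have "d * j \<le> n"
          using that monic_polys_power[OF pm, of j] monic_polys_mult_cancel(1) hm by (metis dvdE)
        then show ?thesis
          using monic_irreducibles_degree_pos[OF p] by (cases d) auto
      qed
      have k: "p ^ k dvd h" unfolding k_def
        by (rule GreatestI_nat[of "\<lambda>k. p ^ k dvd h" 0 n]) (use bound in auto)
      have "\<not> p ^ Suc k dvd h"
        using Greatest_le_nat[of "\<lambda>k. p ^ k dvd h" "Suc k" n] bound unfolding k_def by auto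
      moreover obtain f where f: "h = p ^ k * f" using k by blast
      ultimately have nd: "\<not> p dvd f" by (metis mult_dvd_mono dvd_refl power_Suc2)
      have "f \<in> monic_polys (n - d * k)" "d * k \<le> n"
        using monic_polys_mult_cancel[of "p ^ k" f n "d * k"] monic_polys_power[OF pm] hm f by auto
      moreover have "r \<in> P" if "r \<in> monic_irreducibles e" "r dvd f" for r e
        using that h nd unfolding f smooth_polys_def by auto
      ultimately show "h \<in> (\<lambda>(k, f). p ^ k * f) ` (SIGMA k:{k. d * k \<le> n}. smooth_polys P (n - d * k))"
        using f by (intro image_eqI[of _ _ "(k, f)"]) (auto simp: smooth_polys_def)
    qed
  qed
qed

definition multiplicative_weight :: "('a :: field poly \<Rightarrow> 'b :: comm_ring_1) \<Rightarrow> bool" where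
  "multiplicative_weight w \<longleftrightarrow> w 1 = 1 \<and>
     (\<forall>f g. lead_coeff f = 1 \<longrightarrow> lead_coeff g = 1 \<longrightarrow> coprime f g \<longrightarrow> w (f * g) = w f * w g)"

text \<open>The series \<open>\<Sum>\<^sub>k w(p\<^sup>k) u\<^bsup>k deg p\<^esup>\<close>.\<close>

definition euler_factor :: "('a :: field poly \<Rightarrow> 'b :: comm_ring_1) \<Rightarrow> 'a poly \<Rightarrow> 'b fps" where
  "euler_factor w p =
     Abs_fps (\<lambda>m. if degree p dvd m then w (p ^ (m div degree p)) else 0)"

text \<open>The series \<open>\<Sum>\<^sub>f w(f) u\<^bsup>deg f\<^esup>\<close> over all monic \<open>f\<close>, an analogue of a Dirichlet series.\<close>

definition weight_series :: "('a :: field poly \<Rightarrow> 'b :: comm_ring_1) \<Rightarrow> 'b fps" where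
  "weight_series w = Abs_fps (\<lambda>n. \<Sum>f\<in>monic_polys n. w f)"

text \<open>By induction on \<open>P\<close>: multiplying by the factor of a further irreducible \<open>p\<close> is a Cauchy product
  whose terms are indexed by the pairs of \<open>smooth_polys_insert\<close>.\<close>

lemma partial_euler_product:
  fixes w :: "'a :: {field, finite} poly \<Rightarrow> 'b :: comm_ring_1"
  assumes w: "multiplicative_weight w" and "finite P" "P \<subseteq> (\<Union>d. monic_irreducibles d)"
  shows "(\<Prod>p\<in>P. euler_factor w p) = Abs_fps (\<lambda>n. \<Sum>f\<in>smooth_polys P n. w f)"
  using assms(2,3)
proof (induction P rule: finite_induct)
  case empty
  then show ?case using w by (simp add: smooth_polys_empty multiplicative_weight_def fps_eq_iff)
next
  case (insert p P)
  then obtain d where p: "p \<in> monic_irreducibles d" by auto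
  have d: "d > 0" by (rule monic_irreducibles_degree_pos[OF p])
  have pm: "p \<in> monic_polys d" by (rule monic_irreducibles_monic[OF p])
  have deg: "degree p = d" using p by (simp add: monic_irreducibles_def)
  have wmult: "w (p ^ k * f) = w (p ^ k) * w f" if "f \<in> smooth_polys P m" for f k m
  proof -
    have "\<not> p dvd f" using that p insert.hyps by (auto simp: smooth_polys_def)
    then have "coprime f p"
      using p irreducible_coprime_iff[of p f] by (simp add: monic_irreducibles_def coprime_commute)
    then have "coprime (p ^ k) f" by (simp add: coprime_power_right_bezout coprime_commute)
    then show ?thesis
      using w that monic_polys_power[OF pm, of k]
      unfolding multiplicative_weight_def smooth_polys_def monic_polys_def by blast
  qed
  have "fps_nth (euler_factor w p * Abs_fps (\<lambda>n. \<Sum>f\<in>smooth_polys P n. w f)) n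
          = (\<Sum>f\<in>smooth_polys (insert p P) n. w f)" for n
  proof -
    have fin: "finite {k. d * k \<le> n}"
      by (rule finite_subset[of _ "{..n}"]) (use d in \<open>auto intro: order.trans[rotated]\<close>)
    have "fps_nth (euler_factor w p * Abs_fps (\<lambda>n. \<Sum>f\<in>smooth_polys P n. w f)) n
        = (\<Sum>m=0..n. (if d dvd m then w (p ^ (m div d)) else 0) * (\<Sum>f\<in>smooth_polys P (n - m). w f))"
      by (simp add: fps_mult_nth euler_factor_def deg cong: if_cong)
    also have "\<dots> = (\<Sum>m\<in>(\<lambda>k. d * k) ` {k. d * k \<le> n}.
        (if d dvd m then w (p ^ (m div d)) else 0) * (\<Sum>f\<in>smooth_polys P (n - m). w f))"
      by (rule sum.mono_neutral_right) (auto elim!: dvdE)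
    also have "\<dots> = (\<Sum>k | d * k \<le> n. w (p ^ k) * (\<Sum>f\<in>smooth_polys P (n - d * k). w f))"
      using d by (subst sum.reindex) (auto simp: inj_on_def)
    also have "\<dots> = (\<Sum>k | d * k \<le> n. \<Sum>f\<in>smooth_polys P (n - d * k). w (p ^ k * f))"
      by (intro sum.cong refl) (simp add: sum_distrib_left wmult)
    also have "\<dots> = (\<Sum>(k, f)\<in>(SIGMA k:{k. d * k \<le> n}. smooth_polys P (n - d * k)). w (p ^ k * f))"
      by (rule sum.Sigma) (auto simp: fin finite_smooth_polys)
    also have "\<dots> = (\<Sum>f\<in>smooth_polys (insert p P) n. w f)"
      using sum.reindex_bij_betw[OF smooth_polys_insert[OF p insert.hyps(2), of n], of w]
      by (simp add: case_prod_unfold)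
    finally show ?thesis .
  qed
  then have "euler_factor w p * Abs_fps (\<lambda>n. \<Sum>f\<in>smooth_polys P n. w f)
      = Abs_fps (\<lambda>n. \<Sum>f\<in>smooth_polys (insert p P) n. w f)" by (simp add: fps_eq_iff)
  then show ?case using insert by simp
qed

text \<open>Up to degree \<open>D + 1\<close> every monic polynomial is a product of irreducibles of degree at most
  \<open>D + 1\<close>, so the coefficients of the partial products stabilise.\<close>

lemma euler_product:
  fixes w :: "'a :: {field, finite} poly \<Rightarrow> 'b :: comm_ring_1"
  assumes w: "multiplicative_weight w"
    and E: "\<And>i p. p \<in> monic_irreducibles (Suc i) \<Longrightarrow> euler_factor w p = E i"
    and "n \<le> D"
  shows "fps_nth (\<Prod>i\<le>D. E i ^ num_monic_irred TYPE('a) (Suc i)) n = fps_nth (weight_series w) n"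
proof -
  define P where "P = (\<Union>i\<in>{..D}. monic_irreducibles (Suc i) :: 'a poly set)"
  have "(\<Prod>i\<le>D. E i ^ num_monic_irred TYPE('a) (Suc i))
      = (\<Prod>i\<le>D. \<Prod>p\<in>(monic_irreducibles (Suc i) :: 'a poly set). E i)"
    by (simp add: num_monic_irred_def monic_irreducibles_def)
  also have "\<dots> = (\<Prod>i\<le>D. \<Prod>p\<in>monic_irreducibles (Suc i). euler_factor w p)"
    by (intro prod.cong refl) (simp add: E)
  also have "\<dots> = (\<Prod>p\<in>P. euler_factor w p)"
    unfolding P_def
    by (rule prod.UNION_disjoint[symmetric])
      (simp_all add: finite_monic_irreducibles, auto simp: monic_irreducibles_def)
  also have "\<dots> = Abs_fps (\<lambda>n. \<Sum>f\<in>smooth_polys P n. w f)"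
    by (rule partial_euler_product[OF w]) (auto simp: P_def finite_monic_irreducibles)
  finally have "fps_nth (\<Prod>i\<le>D. E i ^ num_monic_irred TYPE('a) (Suc i)) n
      = (\<Sum>f\<in>smooth_polys P n. w f)" by simp
  also have "smooth_polys P n = monic_polys n"
  proof (rule smooth_polys_all)
    fix d assume "d \<le> n"
    show "monic_irreducibles d \<subseteq> P"
    proof
      fix p :: "'a poly" assume p: "p \<in> monic_irreducibles d"
      then obtain i where "d = Suc i" using monic_irreducibles_degree_pos gr0_implies_Suc by blast
      then show "p \<in> P" using p \<open>d \<le> n\<close> \<open>n \<le> D\<close> unfolding P_def by auto
    qed
  qed
  finally show ?thesis by (simp add: weight_series_def)
qed

text \<open>Power series converge when each coefficient is eventually constant. The limit has to be
  nonzero because a product tending to \<open>0\<close> through nonzero factors does not count as convergent.\<close>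

lemma convergent_prod_fps:
  fixes f :: "nat \<Rightarrow> 'b :: idom fps"
  assumes "\<And>n D. n \<le> D \<Longrightarrow> fps_nth (\<Prod>i\<le>D. f i) n = fps_nth S n" "S \<noteq> 0"
  shows "convergent_prod f" "prodinf f = S"
proof -
  have "(\<lambda>D. \<Prod>i\<le>D. f i) \<longlonglongrightarrow> S"
  proof (rule tendsto_fpsI)
    fix n
    show "\<forall>\<^sub>F D in sequentially. fps_nth (\<Prod>i\<le>D. f i) n = fps_nth S n"
      using eventually_ge_at_top[of n] by eventually_elim (rule assms(1))
  qed
  then have "raw_has_prod f 0 S" using assms(2) by (simp add: raw_has_prod_def)
  then show "convergent_prod f" "prodinf f = S"
    using has_prod_unique[of f S] by (auto simp: convergent_prod_def has_prod_def)
qed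

section \<open>The action of polynomials in a matrix on a vector\<close>

text \<open>This is \<open>f(A) v\<close>, evaluated by Horner's scheme, so that its properties follow by induction
  along \<open>pCons\<close>.\<close>

definition poly_act :: "'a :: field mat \<Rightarrow> 'a poly \<Rightarrow> 'a Matrix.vec \<Rightarrow> 'a Matrix.vec" where
  "poly_act A f v =
     fold_coeffs (\<lambda>a w. a \<cdot>\<^sub>v v + A *\<^sub>v w) f (0\<^sub>v (dim_row A))"

lemma eq_matI_mult_vec:
  fixes A B :: "'a :: field mat"
  assumes A: "A \<in> carrier_mat n n" and B: "B \<in> carrier_mat n n"
    and eq: "\<And>v. v \<in> carrier_vec n \<Longrightarrow> A *\<^sub>v v = B *\<^sub>v v"
  shows "A = B"
proof (rule eq_matI)
  fix i j assume ij: "i < dim_row B" "j < dim_col B"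
  have "(A *\<^sub>v unit_vec n j) $ i = (B *\<^sub>v unit_vec n j) $ i" using eq by simp
  then show "A $$ (i, j) = B $$ (i, j)" using A B ij by (simp add: scalar_prod_right_unit)
qed (use A B in auto)

lemma mult_mat_zero_vec:
  fixes A :: "'a :: field mat"
  assumes "A \<in> carrier_mat n n"
  shows "A *\<^sub>v 0\<^sub>v n = 0\<^sub>v n"
  using assms by (intro eq_vecI) auto

context
  fixes A :: "'a :: field mat" and n :: nat
  assumes A: "A \<in> carrier_mat n n"
begin

lemma poly_act_0: "poly_act A 0 v = 0\<^sub>v n"
  using A by (simp add: poly_act_def)

lemma poly_act_pCons:
  assumes v: "v \<in> carrier_vec n"
  shows "poly_act A (pCons a f) v = a \<cdot>\<^sub>v v + A *\<^sub>v poly_act A f v"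
proof (cases "a = 0 \<and> f = 0")
  case True
  then show ?thesis using v A mult_mat_zero_vec[OF A] poly_act_0 by (auto intro!: eq_vecI)
next
  case False
  then consider "a \<noteq> 0" | "f \<noteq> 0" by blast
  then show ?thesis by cases (simp_all add: poly_act_def)
qed

lemma poly_act_carrier [simp]:
  assumes "v \<in> carrier_vec n"
  shows "poly_act A f v \<in> carrier_vec n"
proof (induction f)
  case 0
  show ?case by (simp add: poly_act_0)
next
  case (pCons a f)
  then show ?case using A assms by (simp add: poly_act_pCons)
qed

lemma poly_act_1:
  assumes "v \<in> carrier_vec n"
  shows "poly_act A 1 v = v"
  using assms A unfolding one_pCons
  by (simp add: poly_act_pCons poly_act_0 mult_mat_zero_vec del: one_pCons pCons_one)

lemma poly_act_add:
  assumes v: "v \<in> carrier_vec n"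
  shows "poly_act A (f + g) v = poly_act A f v + poly_act A g v"
proof (induction f g rule: poly_induct2)
  case 0
  show ?case by (simp add: poly_act_0)
next
  case (pCons a f b g)
  have "poly_act A (pCons a f + pCons b g) v
      = (a + b) \<cdot>\<^sub>v v + (A *\<^sub>v poly_act A f v + A *\<^sub>v poly_act A g v)"
    using pCons A v by (simp add: poly_act_pCons mult_add_distrib_mat_vec[of A n n])
  also have "\<dots> = (a \<cdot>\<^sub>v v + A *\<^sub>v poly_act A f v) + (b \<cdot>\<^sub>v v + A *\<^sub>v poly_act A g v)"
    using A v by (intro eq_vecI) (auto simp: algebra_simps simp del: index_mult_mat_vec)
  finally show ?case using v by (simp add: poly_act_pCons)
qed

lemma poly_act_smult:
  assumes v: "v \<in> carrier_vec n"
  shows "poly_act A (Polynomial.smult c f) v = c \<cdot>\<^sub>v poly_act A f v"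
proof (induction f)
  case 0
  show ?case by (auto simp: poly_act_0 intro!: eq_vecI)
next
  case (pCons a f)
  have "poly_act A (Polynomial.smult c (pCons a f)) v
      = (c * a) \<cdot>\<^sub>v v + c \<cdot>\<^sub>v (A *\<^sub>v poly_act A f v)"
    using pCons A v by (simp add: poly_act_pCons mult_mat_vec[of A n n])
  also have "\<dots> = c \<cdot>\<^sub>v (a \<cdot>\<^sub>v v + A *\<^sub>v poly_act A f v)"
    using A v by (intro eq_vecI) (auto simp: algebra_simps simp del: index_mult_mat_vec)
  finally show ?case using v by (simp add: poly_act_pCons)
qed

lemma poly_act_diff:
  assumes v: "v \<in> carrier_vec n"
  shows "poly_act A (f - g) v = poly_act A f v - poly_act A g v"
proof -
  have "poly_act A (f - g) v = poly_act A (f + Polynomial.smult (- 1) g) v" by simp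
  also have "\<dots> = poly_act A f v - poly_act A g v"
    unfolding poly_act_add[OF v] poly_act_smult[OF v]
    using poly_act_carrier[OF v] by (intro eq_vecI) auto
  finally show ?thesis .
qed

lemma poly_act_mult:
  assumes v: "v \<in> carrier_vec n"
  shows "poly_act A (f * g) v = poly_act A f (poly_act A g v)"
proof (induction f)
  case 0
  show ?case by (simp add: poly_act_0)
next
  case (pCons a f)
  have "poly_act A (pCons a f * g) v = a \<cdot>\<^sub>v poly_act A g v + (0 \<cdot>\<^sub>v v + A *\<^sub>v poly_act A (f * g) v)"
    using v by (simp add: poly_act_add poly_act_smult poly_act_pCons)
  also have "0 \<cdot>\<^sub>v v + A *\<^sub>v poly_act A (f * g) v = A *\<^sub>v poly_act A (f * g) v"
    using v A by (intro eq_vecI) (auto simp del: index_mult_mat_vec)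
  finally show ?case using v pCons by (simp add: poly_act_pCons)
qed

lemma poly_act_commute:
  assumes "v \<in> carrier_vec n"
  shows "poly_act A f (poly_act A g v) = poly_act A g (poly_act A f v)"
  using assms by (metis poly_act_mult mult.commute)

lemma poly_act_zero_vec: "poly_act A f (0\<^sub>v n) = 0\<^sub>v n"
proof -
  have "poly_act A f (poly_act A 0 (0\<^sub>v n)) = poly_act A (f * 0) (0\<^sub>v n)"
    by (subst poly_act_mult) simp_all
  then show ?thesis by (simp add: poly_act_0)
qed

lemma poly_act_mult_mat:
  assumes v: "v \<in> carrier_vec n"
  shows "A *\<^sub>v poly_act A f v = poly_act A (pCons 0 f) v"
  using A v poly_act_pCons[OF v, of 0 f] by (auto intro!: eq_vecI simp del: index_mult_mat_vec)

lemma poly_act_monom: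
  assumes v: "v \<in> carrier_vec n"
  shows "poly_act A (monom 1 i) v = (A ^\<^sub>m i) *\<^sub>v v"
  using v
proof (induction i arbitrary: v)
  case 0
  then show ?case using A by (simp add: poly_act_1)
next
  case (Suc i)
  have X: "poly_act A (monom 1 1) v = A *\<^sub>v v"
    using poly_act_mult_mat[OF Suc.prems, of 1] Suc.prems by (simp add: poly_act_1 monom_Suc)
  have "poly_act A (monom 1 (Suc i)) v = poly_act A (monom 1 i * monom 1 1) v"
    by (simp add: mult_monom)
  also have "\<dots> = poly_act A (monom 1 i) (A *\<^sub>v v)"
    using Suc.prems X by (simp add: poly_act_mult)
  also have "\<dots> = (A ^\<^sub>m i) *\<^sub>v (A *\<^sub>v v)" by (rule Suc.IH) (use A Suc.prems in simp)
  also have "\<dots> = (A ^\<^sub>m Suc i) *\<^sub>v v" using A Suc.prems by (simp add: assoc_mult_mat_vec[of _ n n _ n])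
  finally show ?case .
qed

end

definition cyclic_vector :: "nat \<Rightarrow> 'a :: field mat \<Rightarrow> 'a Matrix.vec \<Rightarrow> bool" where
  "cyclic_vector n A v \<longleftrightarrow> A \<in> carrier_mat n n \<and> v \<in> carrier_vec n \<and>
     (\<forall>w \<in> carrier_vec n. \<exists>f. poly_act A f v = w)"

text \<open>A linear combination of the vectors \<open>A\<^sup>i v\<close> is \<open>f(A) v\<close> for the polynomial \<open>f\<close> with the same
  coefficients. This turns spanning into surjectivity of the evaluation map.\<close>

lemma span_powers_eq:
  fixes A :: "'a :: field mat"
  assumes A: "A \<in> carrier_mat n n" and v: "v \<in> carrier_vec n"
  shows "LinearCombinations.module.span class_ring (module_vec TYPE('a) n)
           {(A ^\<^sub>m i) *\<^sub>v v | i. True} = range (\<lambda>f. poly_act A f v)"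
proof -
  interpret vec_space "TYPE('a)" n .
  let ?S = "{(A ^\<^sub>m i) *\<^sub>v v | i. True}"
  have S: "?S \<subseteq> carrier_vec n" using A v by (auto intro!: mult_mat_vec_carrier pow_carrier_mat)
  show ?thesis
  proof
    show "span ?S \<subseteq> range (\<lambda>f. poly_act A f v)"
    proof
      fix w assume "w \<in> span ?S"
      then obtain a T where w: "w = lincomb a T" and T: "finite T" "T \<subseteq> ?S"
        using in_spanE by blast
      from T have "lincomb a T \<in> range (\<lambda>f. poly_act A f v)"
      proof (induction T rule: finite_induct)
        case empty
        have "lincomb a {} = poly_act A 0 v" unfolding poly_act_0[OF A] by (simp add: lincomb_def)
        then show ?case by blast
      next
        case (insert u T)
        then obtain i f where u: "u = poly_act A (monom 1 i) v" and f: "lincomb a T = poly_act A f v"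
          using poly_act_monom[OF A v] by auto
        have "lincomb a (insert u T) = a u \<cdot>\<^sub>v u + lincomb a T"
          using insert S by (subst lincomb_insert2) auto
        also have "\<dots> = poly_act A (Polynomial.smult (a u) (monom 1 i) + f) v"
          using f u by (simp add: poly_act_add[OF A v] poly_act_smult[OF A v])
        finally show ?case by blast
      qed
      then show "w \<in> range (\<lambda>f. poly_act A f v)" using w by simp
    qed
    \<comment> \<open>The induction along Horner's scheme multiplies by \<open>A\<close>, so it is run for all powers of \<open>A\<close> at once.\<close>
    have "(A ^\<^sub>m k) *\<^sub>v poly_act A f v \<in> span ?S" for f k
    proof (induction f arbitrary: k)
      case 0
      have "(A ^\<^sub>m k) *\<^sub>v 0\<^sub>v n = 0\<^sub>v n" using A by (intro mult_mat_zero_vec pow_carrier_mat)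
      moreover have "lincomb (\<lambda>_. 0) {} = 0\<^sub>v n" by (simp add: lincomb_def)
      ultimately show ?case unfolding poly_act_0[OF A]
        using in_spanI[of "0\<^sub>v n" "\<lambda>_. 0" "{}" ?S] by simp
    next
      case (pCons a f)
      have Ak: "A ^\<^sub>m k \<in> carrier_mat n n" using A by (rule pow_carrier_mat)
      have c: "poly_act A f v \<in> carrier_vec n" by (rule poly_act_carrier[OF A v])
      have "(A ^\<^sub>m k) *\<^sub>v poly_act A (pCons a f) v
          = a \<cdot>\<^sub>v ((A ^\<^sub>m k) *\<^sub>v v) + (A ^\<^sub>m Suc k) *\<^sub>v poly_act A f v"
        using A Ak v c by (simp add: poly_act_pCons mult_add_distrib_mat_vec[of _ n n] mult_mat_vec[of _ n n]
            assoc_mult_mat_vec[of _ n n _ n])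
      moreover have "(A ^\<^sub>m k) *\<^sub>v v \<in> span ?S" using in_own_span[of ?S] S by auto
      then have "a \<cdot>\<^sub>v ((A ^\<^sub>m k) *\<^sub>v v) \<in> span ?S" by (rule smult_in_span[OF S])
      ultimately show ?case using span_add1[OF _ _ pCons.IH[of "Suc k"]] S by simp
    qed
    from this[of 0] show "range (\<lambda>f. poly_act A f v) \<subseteq> span ?S"
      using A poly_act_carrier[OF A v] by auto
  qed
qed

lemma cyclic_vector_iff_span:
  "cyclic_vector n A v \<longleftrightarrow> A \<in> carrier_mat n n \<and> v \<in> carrier_vec n \<and>
     LinearCombinations.module.span class_ring (module_vec TYPE('a :: field) n)
       {(A ^\<^sub>m i) *\<^sub>v v | i. True} = carrier_vec n"
proof (cases "A \<in> carrier_mat n n \<and> v \<in> carrier_vec n")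
  case True
  then have A: "A \<in> carrier_mat n n" and v: "v \<in> carrier_vec n" by blast+
  have "range (\<lambda>f. poly_act A f v) \<subseteq> carrier_vec n" using poly_act_carrier[OF A v] by blast
  then have "range (\<lambda>f. poly_act A f v) = carrier_vec n
      \<longleftrightarrow> (\<forall>w \<in> carrier_vec n. w \<in> range (\<lambda>f. poly_act A f v))" by blast
  moreover have "w \<in> range (\<lambda>f. poly_act A f v) \<longleftrightarrow> (\<exists>f. poly_act A f v = w)" for w by blast
  ultimately show ?thesis
    unfolding span_powers_eq[OF A v] cyclic_vector_def using A v by simp
next
  case False
  then show ?thesis unfolding cyclic_vector_def by blast
qed

lemma cyclic_mat_iff_cyclic_vector: "cyclic_mat n A \<longleftrightarrow> (\<exists>v. cyclic_vector n A v)"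
  unfolding cyclic_mat_def cyclic_vector_iff_span by blast

section \<open>Coefficient vectors\<close>

definition coeff_vec :: "nat \<Rightarrow> 'a :: zero poly \<Rightarrow> 'a Matrix.vec" where
  "coeff_vec n f = Matrix.vec n (coeff f)"

lemma coeff_vec_carrier [simp]: "coeff_vec n f \<in> carrier_vec n"
  by (simp add: coeff_vec_def)

lemma coeff_vec_add: "coeff_vec n (f + g) = coeff_vec n f + coeff_vec n g"
  by (auto simp: coeff_vec_def)

lemma coeff_vec_smult: "coeff_vec n (Polynomial.smult c f) = c \<cdot>\<^sub>v coeff_vec n f"
  by (auto simp: coeff_vec_def)

lemma coeff_vec_0: "coeff_vec n 0 = 0\<^sub>v n"
  by (auto simp: coeff_vec_def)

lemma bij_betw_coeff_vec:
  "bij_betw (coeff_vec n) (polys_below n :: 'a :: comm_monoid_add poly set) (carrier_vec n)"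
  unfolding bij_betw_def
proof
  show "inj_on (coeff_vec n) (polys_below n :: 'a poly set)"
  proof (rule inj_onI)
    fix f g :: "'a poly" assume fg: "f \<in> polys_below n" "g \<in> polys_below n" "coeff_vec n f = coeff_vec n g"
    show "f = g"
    proof (rule poly_eqI)
      fix i
      show "coeff f i = coeff g i"
      proof (cases "i < n")
        case True
        then have "coeff_vec n f $ i = coeff f i" "coeff_vec n g $ i = coeff g i"
          by (simp_all add: coeff_vec_def)
        then show ?thesis using fg(3) by simp
      next
        case False
        then show ?thesis using fg by (simp add: polys_below_def)
      qed
    qed
  qed
  show "coeff_vec n ` polys_below n = (carrier_vec n :: 'a Matrix.vec set)"
  proof (intro equalityI subsetI)
    fix v :: "'a Matrix.vec" assume v: "v \<in> carrier_vec n"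
    define f where "f = (\<Sum>i<n. monom (v $ i) i)"
    have c: "coeff f k = (if k < n then v $ k else 0)" for k
      unfolding f_def by (simp add: coeff_sum sum.delta)
    then have "f \<in> polys_below n" "coeff_vec n f = v"
      using v by (auto simp: polys_below_def coeff_vec_def)
    then show "v \<in> coeff_vec n ` polys_below n" by blast
  qed auto
qed

lemma finite_carrier_vec: "finite (carrier_vec n :: 'a :: {field, finite} Matrix.vec set)"
  using bij_betw_finite[OF bij_betw_coeff_vec] finite_polys_below by blast

lemma card_carrier_vec: "card (carrier_vec n :: 'a :: {field, finite} Matrix.vec set) = CARD('a) ^ n"
  using bij_betw_same_card[OF bij_betw_coeff_vec[of n]] card_polys_below[of n, where 'a = 'a] by metis

text \<open>The matrix of a linear map that is given on polynomials of degree below \<open>n\<close>, with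
  respect to the monomial basis.\<close>

definition matrix_of_poly_map :: "nat \<Rightarrow> ('a :: field poly \<Rightarrow> 'a Matrix.vec) \<Rightarrow> 'a mat" where
  "matrix_of_poly_map n L = Matrix.mat n n (\<lambda>(r, c). L (monom 1 c) $ r)"

lemma matrix_of_poly_map_carrier [simp]: "matrix_of_poly_map n L \<in> carrier_mat n n"
  by (simp add: matrix_of_poly_map_def)

lemma matrix_of_poly_map_mult_vec:
  fixes L :: "'a :: field poly \<Rightarrow> 'a Matrix.vec"
  assumes carr: "\<And>f. L f \<in> carrier_vec n"
    and add: "\<And>f g. L (f + g) = L f + L g"
    and smult: "\<And>c f. L (Polynomial.smult c f) = c \<cdot>\<^sub>v L f"
    and f: "f \<in> polys_below n"
  shows "matrix_of_poly_map n L *\<^sub>v coeff_vec n f = L f"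
proof (rule eq_vecI)
  fix r assume "r < dim_vec (L f)"
  then have r: "r < n" using carr by (metis carrier_vecD)
  have "L g $ r = (\<Sum>c<m. L (monom 1 c) $ r * coeff g c)" if "g \<in> polys_below m" for g m
    using that
  proof (induction m arbitrary: g)
    case 0
    have "L 0 = 0 \<cdot>\<^sub>v L 0" using smult[of 0 0] by simp
    also have "\<dots> $ r = 0" using r carr[of 0] by simp
    finally show ?case using 0 by (simp add: polys_below_0)
  next
    case (Suc m)
    define h where "h = g - monom (coeff g m) m"
    have c: "coeff h i = (if i = m then 0 else coeff g i)" for i by (simp add: h_def)
    then have "h \<in> polys_below m" using Suc.prems by (auto simp: polys_below_def)
    have "g = h + Polynomial.smult (coeff g m) (monom 1 m)" by (simp add: h_def smult_monom)
    then have "L g = L h + coeff g m \<cdot>\<^sub>v L (monom 1 m)" using add smult by metis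
    then have "L g $ r = L h $ r + L (monom 1 m) $ r * coeff g m"
      using r carr[of h] carr[of "monom 1 m"] by (simp add: mult.commute)
    also have "L h $ r = (\<Sum>c<m. L (monom 1 c) $ r * coeff g c)"
      unfolding Suc.IH[OF \<open>h \<in> polys_below m\<close>] by (intro sum.cong) (auto simp: c)
    finally show ?case by simp
  qed
  from this[OF f] show "(matrix_of_poly_map n L *\<^sub>v coeff_vec n f) $ r = L f $ r"
    using r by (simp add: matrix_of_poly_map_def coeff_vec_def scalar_prod_def lessThan_atLeast0)
qed (simp add: matrix_of_poly_map_def carrier_vecD[OF carr])

section \<open>The relation polynomial of a cyclic vector\<close>

context
  fixes A :: "'a :: {field, finite} mat" and n :: nat and v :: "'a Matrix.vec"
  assumes cv: "cyclic_vector n A v"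
begin

lemma cyclic_vector_carriers: "A \<in> carrier_mat n n" "v \<in> carrier_vec n"
  using cv by (simp_all add: cyclic_vector_def)

text \<open>A relation of least degree \<open>m\<close> identifies the polynomials of degree below \<open>m\<close> with the
  whole space, so \<open>m\<close> is the dimension by counting.\<close>

lemma cyclic_vector_relation_exists: "\<exists>f \<in> monic_polys n. poly_act A f v = 0\<^sub>v n"
proof -
  note A = cyclic_vector_carriers(1) and v = cyclic_vector_carriers(2)
  let ?rel = "\<lambda>f. f \<noteq> 0 \<and> poly_act A f v = 0\<^sub>v n"
  have diff: "poly_act A (f - g) v = 0\<^sub>v n" if "poly_act A f v = poly_act A g v" for f g
    unfolding poly_act_diff[OF A v] that by (rule minus_cancel_vec[OF poly_act_carrier[OF A v]])
  \<comment> \<open>There are more polynomials of degree at most \<open>n\<close> than vectors, so some relation exists.\<close>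
  have "\<not> inj_on (\<lambda>f. poly_act A f v) (polys_below (Suc n))"
  proof
    assume "inj_on (\<lambda>f. poly_act A f v) (polys_below (Suc n))"
    then have "card (polys_below (Suc n) :: 'a poly set) \<le> card (carrier_vec n :: 'a Matrix.vec set)"
      by (rule card_inj_on_le) (use poly_act_carrier[OF A v] finite_carrier_vec in auto)
    moreover note card_finite_field_gt_1[where 'a = 'a]
    ultimately show False by (simp add: card_polys_below card_carrier_vec)
  qed
  then obtain f g where "f \<noteq> g" "poly_act A f v = poly_act A g v" unfolding inj_on_def by blast
  then have "?rel (f - g)" using diff by simp
  then obtain h where h: "?rel h" and least: "\<And>g. ?rel g \<Longrightarrow> degree h \<le> degree g"
    using exists_least_iff[of "\<lambda>k. \<exists>g. ?rel g \<and> degree g = k"] by (metis (mono_tags, lifting) not_less)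
  have "inj_on (\<lambda>f. poly_act A f v) (polys_below (degree h))"
  proof (rule inj_onI)
    fix f g assume fg: "f \<in> polys_below (degree h)" "g \<in> polys_below (degree h)"
      and "poly_act A f v = poly_act A g v"
    then have rel: "poly_act A (f - g) v = 0\<^sub>v n" using diff by blast
    have "f - g = 0 \<or> degree (f - g) < degree h"
      using polys_below_diff[OF fg] by (simp add: polys_below_iff)
    then have "f - g = 0" using least[of "f - g"] rel by (meson not_less)
    then show "f = g" by simp
  qed
  moreover have "(\<lambda>f. poly_act A f v) ` polys_below (degree h) = carrier_vec n"
  proof (intro equalityI subsetI)
    fix w :: "'a Matrix.vec" assume "w \<in> carrier_vec n"
    then obtain f where f: "poly_act A f v = w" using cv by (auto simp: cyclic_vector_def)
    have "poly_act A f v = poly_act A (f div h * h + f mod h) v" by simp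
    also have "\<dots> = poly_act A (f mod h) v"
      using h unfolding poly_act_add[OF A v] poly_act_mult[OF A v]
      using poly_act_carrier[OF A v] by (simp add: poly_act_zero_vec[OF A])
    finally show "w \<in> (\<lambda>f. poly_act A f v) ` polys_below (degree h)"
      using f h mod_in_polys_below by blast
  qed (use poly_act_carrier[OF A v] in auto)
  ultimately have "card (polys_below (degree h) :: 'a poly set) = card (carrier_vec n :: 'a Matrix.vec set)"
    using card_image by fastforce
  then have "CARD('a) ^ degree h = CARD('a) ^ n" by (simp add: card_polys_below card_carrier_vec)
  moreover note card_finite_field_gt_1[where 'a = 'a]
  ultimately have "degree h = n" by simp
  then have "Polynomial.smult (inverse (lead_coeff h)) h \<in> monic_polys n"
    using h by (auto simp: monic_polys_def)
  moreover have "poly_act A (Polynomial.smult (inverse (lead_coeff h)) h) v = 0\<^sub>v n"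
    unfolding poly_act_smult[OF A v] using h by (auto intro!: eq_vecI)
  ultimately show ?thesis by blast
qed

context
  fixes f :: "'a poly"
  assumes f: "f \<in> monic_polys n" and rel: "poly_act A f v = 0\<^sub>v n"
begin

lemma poly_act_mod_relation: "poly_act A (g mod f) v = poly_act A g v"
proof -
  note A = cyclic_vector_carriers(1) and v = cyclic_vector_carriers(2)
  have "poly_act A g v = poly_act A (g div f * f + g mod f) v" by simp
  also have "\<dots> = poly_act A (g mod f) v"
    unfolding poly_act_add[OF A v] poly_act_mult[OF A v] rel
    using poly_act_carrier[OF A v] by (simp add: poly_act_zero_vec[OF A])
  finally show ?thesis ..
qed

text \<open>Reduction modulo \<open>f\<close> shows that the polynomials of degree below \<open>n\<close> already reach every
  vector; both sides have \<open>q\<^sup>n\<close> elements.\<close>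

lemma bij_betw_poly_act: "bij_betw (\<lambda>g. poly_act A g v) (polys_below n) (carrier_vec n)"
proof -
  note A = cyclic_vector_carriers(1) and v = cyclic_vector_carriers(2)
  have n: "degree f = n" "f \<noteq> 0" using f by (auto simp: monic_polys_def)
  have onto: "(\<lambda>g. poly_act A g v) ` polys_below n = carrier_vec n"
  proof (intro equalityI subsetI)
    fix w :: "'a Matrix.vec" assume "w \<in> carrier_vec n"
    then obtain g where "poly_act A g v = w" using cv by (auto simp: cyclic_vector_def)
    then have "w = poly_act A (g mod f) v" by (simp add: poly_act_mod_relation)
    moreover have "g mod f \<in> polys_below n" using mod_in_polys_below[OF n(2), of g] n(1) by simp
    ultimately show "w \<in> (\<lambda>g. poly_act A g v) ` polys_below n" by blast
  qed (use poly_act_carrier[OF A v] in auto)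
  then have "inj_on (\<lambda>g. poly_act A g v) (polys_below n)"
    by (intro eq_card_imp_inj_on) (simp_all add: finite_polys_below card_polys_below card_carrier_vec)
  then show ?thesis using onto by (simp add: bij_betw_def)
qed

lemma poly_act_eq_zero_iff: "poly_act A g v = 0\<^sub>v n \<longleftrightarrow> f dvd g"
proof
  note A = cyclic_vector_carriers(1)
  have n: "degree f = n" "f \<noteq> 0" using f by (auto simp: monic_polys_def)
  assume "poly_act A g v = 0\<^sub>v n"
  then have "poly_act A (g mod f) v = poly_act A 0 v"
    by (simp add: poly_act_mod_relation poly_act_0[OF A])
  moreover have "g mod f \<in> polys_below n" "0 \<in> polys_below n"
    using mod_in_polys_below[OF n(2), of g] n(1) by (auto simp: polys_below_def)
  ultimately have "g mod f = 0"
    using bij_betw_poly_act unfolding bij_betw_def inj_on_def by blast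
  then show "f dvd g" by (simp add: mod_eq_0_iff_dvd)
next
  assume "f dvd g"
  then have "poly_act A g v = poly_act A 0 v" using poly_act_mod_relation[of g] by simp
  then show "poly_act A g v = 0\<^sub>v n" by (simp add: poly_act_0[OF cyclic_vector_carriers(1)])
qed

text \<open>Moving from \<open>v\<close> to \<open>g(A) v\<close> corresponds to multiplication by \<open>g\<close> modulo \<open>f\<close>, which is
  onto exactly for units.\<close>

lemma cyclic_vector_poly_act_iff: "cyclic_vector n A (poly_act A g v) \<longleftrightarrow> coprime g f"
proof
  note A = cyclic_vector_carriers(1) and v = cyclic_vector_carriers(2)
  assume "cyclic_vector n A (poly_act A g v)"
  then obtain h where "poly_act A h (poly_act A g v) = v" using v by (auto simp: cyclic_vector_def)
  then have "poly_act A (h * g) v = poly_act A 1 v"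
    by (simp add: poly_act_mult[OF A v] poly_act_1[OF A v])
  then have "poly_act A (h * g - 1) v = 0\<^sub>v n"
    unfolding poly_act_diff[OF A v] using v by (simp add: poly_act_1[OF A v])
  then obtain k where "h * g - 1 = f * k" using poly_act_eq_zero_iff by blast
  then have "h * g + (- k) * f = 1" by (simp add: algebra_simps)
  then show "coprime g f" by (rule bezout_coprime)
next
  note A = cyclic_vector_carriers(1) and v = cyclic_vector_carriers(2)
  assume "coprime g f"
  then obtain x y where xy: "x * g + y * f = 1" using coprime_bezout by blast
  have "poly_act A (h * x) (poly_act A g v) = poly_act A h v" for h
  proof -
    have "h * (x * g) + h * y * f = h" using arg_cong[OF xy, of "\<lambda>p. h * p"] by (simp add: algebra_simps)
    then have "f dvd h * x * g - h" by (metis add_diff_cancel_left' diff_add_cancel dvd_diff_commute dvd_triv_right mult.assoc)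
    then have "(h * x * g) mod f = h mod f" by (simp add: mod_eq_dvd_iff)
    then show ?thesis using poly_act_mod_relation by (metis poly_act_mult[OF A v])
  qed
  then show "cyclic_vector n A (poly_act A g v)"
    using cv poly_act_carrier[OF A v] unfolding cyclic_vector_def by metis
qed

end

end

definition cyclic_pairs :: "nat \<Rightarrow> 'a :: field poly \<Rightarrow> ('a mat \<times> 'a Matrix.vec) set" where
  "cyclic_pairs n f = {(A, v). cyclic_vector n A v \<and> poly_act A f v = 0\<^sub>v n}"

text \<open>Every vector is \<open>g(A) v\<close> for some \<open>g\<close>, and \<open>f(A)\<close> commutes with \<open>g(A)\<close>; so \<open>f(A) = 0\<close>.\<close>

lemma cyclic_pairs_relation:
  assumes "(A, v) \<in> cyclic_pairs n f" "w \<in> carrier_vec n"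
  shows "poly_act A f w = 0\<^sub>v n"
proof -
  have A: "A \<in> carrier_mat n n" and v: "v \<in> carrier_vec n"
    using assms(1) by (simp_all add: cyclic_pairs_def cyclic_vector_def)
  obtain g where "poly_act A g v = w" using assms by (auto simp: cyclic_pairs_def cyclic_vector_def)
  then have "poly_act A f w = poly_act A g (poly_act A f v)" using poly_act_commute[OF A v] by metis
  then show ?thesis using assms(1) by (simp add: cyclic_pairs_def poly_act_zero_vec[OF A])
qed

lemma card_cyclic_pairs_fibre:
  fixes A :: "'a :: {field, finite} mat"
  assumes f: "f \<in> monic_polys n" and Av: "(A, v) \<in> cyclic_pairs n f"
  shows "card {w. (A, w) \<in> cyclic_pairs n f} = num_units_mod f"
proof -
  have cv: "cyclic_vector n A v" and rel: "poly_act A f v = 0\<^sub>v n"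
    using Av by (auto simp: cyclic_pairs_def)
  have n: "degree f = n" using f by (auto simp: monic_polys_def)
  note bij = bij_betw_poly_act[OF cv f rel]
  have "{w. (A, w) \<in> cyclic_pairs n f} = (\<lambda>g. poly_act A g v) ` unit_residues f"
  proof (intro equalityI subsetI)
    fix w assume "w \<in> {w. (A, w) \<in> cyclic_pairs n f}"
    then have w: "cyclic_vector n A w" by (simp add: cyclic_pairs_def)
    then have "w \<in> (\<lambda>g. poly_act A g v) ` polys_below n"
      using bij by (simp add: bij_betw_def cyclic_vector_def)
    then obtain g where "g \<in> polys_below n" "w = poly_act A g v" by blast
    then show "w \<in> (\<lambda>g. poly_act A g v) ` unit_residues f"
      using cyclic_vector_poly_act_iff[OF cv f rel] w n by (auto simp: unit_residues_def)
  next
    fix w assume "w \<in> (\<lambda>g. poly_act A g v) ` unit_residues f"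
    then obtain g where "coprime g f" "w = poly_act A g v" by (auto simp: unit_residues_def)
    then have "cyclic_vector n A w" using cyclic_vector_poly_act_iff[OF cv f rel] by simp
    moreover from this have "poly_act A f w = 0\<^sub>v n"
      using cyclic_pairs_relation[OF Av] by (simp add: cyclic_vector_def)
    ultimately show "w \<in> {w. (A, w) \<in> cyclic_pairs n f}" by (simp add: cyclic_pairs_def)
  qed
  moreover have "inj_on (\<lambda>g. poly_act A g v) (unit_residues f)"
    using bij_betw_imp_inj_on[OF bij] by (rule inj_on_subset) (auto simp: unit_residues_def n)
  ultimately show ?thesis by (simp add: card_image num_units_mod_def)
qed

section \<open>Counting cyclic matrices\<close>

definition GL_set :: "nat \<Rightarrow> 'a :: field mat set" where
  "GL_set n = {A \<in> carrier_mat n n. invertible_mat A}"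

lemma GL_setE:
  assumes "P \<in> GL_set n"
  obtains Q where "P \<in> carrier_mat n n" "Q \<in> carrier_mat n n" "P * Q = 1\<^sub>m n" "Q * P = 1\<^sub>m n"
proof -
  have P: "P \<in> carrier_mat n n" using assms by (simp add: GL_set_def)
  obtain Q where "P * Q = 1\<^sub>m (dim_row P)" "Q * P = 1\<^sub>m (dim_row Q)"
    using assms by (auto simp: GL_set_def invertible_mat_def inverts_mat_def)
  moreover from this have "dim_col Q = n" "dim_row Q = n"
    using P by (metis carrier_matD index_mult_mat(3) index_one_mat(3))+
  ultimately show ?thesis using P by (intro that[of Q]) auto
qed

lemma inj_mult_vec_imp_GL_set:
  fixes A :: "'a :: field mat"
  assumes A: "A \<in> carrier_mat n n"
    and inj: "\<And>v. v \<in> carrier_vec n \<Longrightarrow> A *\<^sub>v v = 0\<^sub>v n \<Longrightarrow> v = 0\<^sub>v n"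
  shows "A \<in> GL_set n"
proof -
  have "det A \<noteq> 0" using det_0_iff_vec_prod_zero_field[OF A] inj by blast
  then have "A \<in> Units (ring_mat TYPE('a) n ())" by (rule det_non_zero_imp_unit[OF A])
  then obtain B where "B \<in> carrier_mat n n" "A * B = 1\<^sub>m n" "B * A = 1\<^sub>m n"
    unfolding Units_def ring_mat_def by auto
  then show ?thesis using A by (auto simp: GL_set_def invertible_mat_def inverts_mat_def)
qed

text \<open>The matrix with columns \<open>v, A v, \<dots>, A\<^sup>n\<^sup>-\<^sup>1 v\<close>.\<close>

definition krylov_mat :: "nat \<Rightarrow> 'a :: field mat \<Rightarrow> 'a Matrix.vec \<Rightarrow> 'a mat" where
  "krylov_mat n A v = matrix_of_poly_map n (\<lambda>f. poly_act A f v)"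

lemma krylov_mat_mult_coeff_vec:
  assumes A: "A \<in> carrier_mat n n" and v: "v \<in> carrier_vec n" and "f \<in> polys_below n"
  shows "krylov_mat n A v *\<^sub>v coeff_vec n f = poly_act A f v"
  unfolding krylov_mat_def
  by (rule matrix_of_poly_map_mult_vec)
    (simp_all add: poly_act_carrier[OF A v] poly_act_add[OF A v] poly_act_smult[OF A v] assms(3))

lemma krylov_mat_in_GL_set:
  fixes A :: "'a :: {field, finite} mat"
  assumes f: "f \<in> monic_polys n" and Av: "(A, v) \<in> cyclic_pairs n f"
  shows "krylov_mat n A v \<in> GL_set n"
proof (rule inj_mult_vec_imp_GL_set)
  show "krylov_mat n A v \<in> carrier_mat n n" by (simp add: krylov_mat_def)
  have cv: "cyclic_vector n A v" and rel: "poly_act A f v = 0\<^sub>v n"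
    using Av by (auto simp: cyclic_pairs_def)
  note A = cyclic_vector_carriers(1)[OF cv] and v = cyclic_vector_carriers(2)[OF cv]
  fix w :: "'a Matrix.vec" assume "w \<in> carrier_vec n" and 0: "krylov_mat n A v *\<^sub>v w = 0\<^sub>v n"
  then obtain g where g: "g \<in> polys_below n" "w = coeff_vec n g"
    using bij_betw_coeff_vec[of n, where 'a = 'a] unfolding bij_betw_def by blast
  then have "poly_act A g v = poly_act A 0 v"
    using 0 krylov_mat_mult_coeff_vec[OF A v g(1)] by (simp add: poly_act_0[OF A])
  moreover have "0 \<in> polys_below n" by (simp add: polys_below_def)
  ultimately have "g = 0"
    using g bij_betw_poly_act[OF cv f rel] unfolding bij_betw_def inj_on_def by blast
  then show "w = 0\<^sub>v n" by (simp add: g coeff_vec_0)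
qed

text \<open>The Krylov matrix and \<open>f\<close> together determine the pair, since they determine every \<open>g(A) v\<close>
  by reduction modulo \<open>f\<close>.\<close>

lemma krylov_mat_inj:
  fixes f :: "'a :: {field, finite} poly"
  assumes f: "f \<in> monic_polys n"
  shows "inj_on (\<lambda>(A, v). krylov_mat n A v) (cyclic_pairs n f)"
proof (rule inj_onI, clarify)
  fix A B :: "'a mat" and v w :: "'a Matrix.vec"
  assume Av: "(A, v) \<in> cyclic_pairs n f" and Bw: "(B, w) \<in> cyclic_pairs n f"
    and eq: "krylov_mat n A v = krylov_mat n B w"
  have cv: "cyclic_vector n A v" "poly_act A f v = 0\<^sub>v n"
    and cw: "cyclic_vector n B w" "poly_act B f w = 0\<^sub>v n"
    using Av Bw by (auto simp: cyclic_pairs_def)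
  note A = cyclic_vector_carriers[OF cv(1)] and B = cyclic_vector_carriers[OF cw(1)]
  have act: "poly_act A g v = poly_act B g w" for g
  proof -
    have "f \<noteq> 0" "degree f = n" using f by (auto simp: monic_polys_def)
    then have "g mod f \<in> polys_below n" using mod_in_polys_below by blast
    then have "poly_act A (g mod f) v = poly_act B (g mod f) w"
      using krylov_mat_mult_coeff_vec A B eq by metis
    then show ?thesis by (simp add: poly_act_mod_relation[OF cv(1) f cv(2)]
          poly_act_mod_relation[OF cw(1) f cw(2)])
  qed
  have "v = w" using act[of 1] by (simp add: poly_act_1[OF A] poly_act_1[OF B])
  moreover have "A = B"
  proof (rule eq_matI_mult_vec[OF A(1) B(1)])
    fix u :: "'a Matrix.vec" assume "u \<in> carrier_vec n"
    then obtain g where g: "u = poly_act A g v" using cv(1) by (auto simp: cyclic_vector_def)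
    have "A *\<^sub>v u = poly_act A (pCons 0 g) v" by (simp add: g poly_act_mult_mat[OF A])
    also have "\<dots> = B *\<^sub>v u" by (simp add: act g poly_act_mult_mat[OF B])
    finally show "A *\<^sub>v u = B *\<^sub>v u" .
  qed
  ultimately show "A = B \<and> v = w" by simp
qed

text \<open>Conversely an invertible \<open>P\<close> transports multiplication by \<open>X\<close> on the residues modulo \<open>f\<close>
  to a matrix with cyclic vector the image of \<open>1\<close>.\<close>

lemma krylov_mat_surj:
  fixes f :: "'a :: {field, finite} poly"
  assumes f: "f \<in> monic_polys n" and "P \<in> GL_set n"
  shows "P \<in> (\<lambda>(A, v). krylov_mat n A v) ` cyclic_pairs n f"
proof -
  have nz: "f \<noteq> 0" and deg: "degree f = n" using f by (auto simp: monic_polys_def)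
  obtain Q where P: "P \<in> carrier_mat n n" and Q: "Q \<in> carrier_mat n n"
    and PQ: "P * Q = 1\<^sub>m n" and QP: "Q * P = 1\<^sub>m n" using GL_setE[OF assms(2)] by blast
  \<comment> \<open>\<open>C\<close> is the companion matrix of \<open>f\<close>.\<close>
  define C where "C = matrix_of_poly_map n (\<lambda>g. coeff_vec n (pCons 0 g mod f))"
  have C: "C \<in> carrier_mat n n" by (simp add: C_def)
  have C_mult: "C *\<^sub>v coeff_vec n g = coeff_vec n (pCons 0 g mod f)" if "g \<in> polys_below n" for g
    unfolding C_def
  proof (rule matrix_of_poly_map_mult_vec)
    fix g h :: "'a poly" and c
    have "pCons 0 (g + h) mod f = pCons 0 g mod f + pCons 0 h mod f"
      using poly_mod_add_left[of "pCons 0 g" "pCons 0 h" f] by simp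
    then show "coeff_vec n (pCons 0 (g + h) mod f)
        = coeff_vec n (pCons 0 g mod f) + coeff_vec n (pCons 0 h mod f)"
      by (simp add: coeff_vec_add)
    have "pCons 0 (Polynomial.smult c g) mod f = Polynomial.smult c (pCons 0 g mod f)"
      using mod_smult_left[of c "pCons 0 g" f] by simp
    then show "coeff_vec n (pCons 0 (Polynomial.smult c g) mod f) = c \<cdot>\<^sub>v coeff_vec n (pCons 0 g mod f)"
      by (simp add: coeff_vec_smult)
  qed (use that in simp_all)
  \<comment> \<open>The residue of \<open>1\<close> is \<open>1\<close> itself except for \<open>n = 0\<close>, where it is \<open>0\<close>.\<close>
  define A where "A = P * (C * Q)"
  define v where "v = P *\<^sub>v coeff_vec n (1 mod f)"
  have A: "A \<in> carrier_mat n n" using P Q C by (simp add: A_def)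
  have v: "v \<in> carrier_vec n" using P by (simp add: v_def)
  have Q_cancel: "Q *\<^sub>v (P *\<^sub>v u) = u" if "u \<in> carrier_vec n" for u
    using P Q QP that by (metis assoc_mult_mat_vec one_mult_mat_vec)
  have P_cancel: "P *\<^sub>v (Q *\<^sub>v u) = u" if "u \<in> carrier_vec n" for u
    using P Q PQ that by (metis assoc_mult_mat_vec one_mult_mat_vec)
  have below: "g mod f \<in> polys_below n" for g using mod_in_polys_below[OF nz] deg by simp
  have act: "poly_act A g v = P *\<^sub>v coeff_vec n (g mod f)" for g
  proof (induction g)
    case 0
    show ?case using P by (simp add: poly_act_0[OF A] coeff_vec_0 mult_mat_zero_vec)
  next
    case (pCons a g)
    have "A *\<^sub>v (P *\<^sub>v coeff_vec n (g mod f)) = P *\<^sub>v (C *\<^sub>v (Q *\<^sub>v (P *\<^sub>v coeff_vec n (g mod f))))"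
      using P Q C by (simp add: A_def assoc_mult_mat_vec[of _ n n _ n])
    also have "\<dots> = P *\<^sub>v coeff_vec n (pCons 0 (g mod f) mod f)"
      by (simp add: Q_cancel C_mult below)
    finally have APg: "A *\<^sub>v (P *\<^sub>v coeff_vec n (g mod f)) = P *\<^sub>v coeff_vec n (pCons 0 (g mod f) mod f)" .
    have "poly_act A (pCons a g) v
        = a \<cdot>\<^sub>v (P *\<^sub>v coeff_vec n (1 mod f)) + P *\<^sub>v coeff_vec n (pCons 0 (g mod f) mod f)"
      unfolding poly_act_pCons[OF A v] pCons APg by (simp add: v_def)
    also have "\<dots>
        = P *\<^sub>v (coeff_vec n (Polynomial.smult a (1 mod f)) + coeff_vec n (pCons 0 (g mod f) mod f))"
      using P by (simp add: coeff_vec_smult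
          mult_mat_vec[of _ n n] mult_add_distrib_mat_vec[of _ n n])
    also have "\<dots> = P *\<^sub>v coeff_vec n (pCons a g mod f)"
    proof -
      have "pCons 0 (g mod f) mod f = pCons 0 g mod f"
        using mod_mult_right_eq[of "[:0, 1:]" g f] by simp
      moreover have "pCons a g = Polynomial.smult a 1 + pCons 0 g" by simp
      ultimately have "Polynomial.smult a (1 mod f) + pCons 0 (g mod f) mod f = pCons a g mod f"
        by (metis mod_smult_left poly_mod_add_left)
      then show ?thesis by (simp add: coeff_vec_add[symmetric])
    qed
    finally show ?case .
  qed
  have act_below: "poly_act A g v = P *\<^sub>v coeff_vec n g" if "g \<in> polys_below n" for g
    using act[of g] mod_polys_below[of g f] that deg by simp
  have onto: "\<exists>g \<in> polys_below n. u = coeff_vec n g" if "u \<in> carrier_vec n" for u :: "'a Matrix.vec"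
    using that bij_betw_coeff_vec[of n, where 'a = 'a] unfolding bij_betw_def by blast
  have "cyclic_vector n A v"
    unfolding cyclic_vector_def
  proof (intro conjI ballI A v)
    fix u :: "'a Matrix.vec" assume u: "u \<in> carrier_vec n"
    have "Q *\<^sub>v u \<in> carrier_vec n" using Q u by simp
    then obtain g where "g \<in> polys_below n" "Q *\<^sub>v u = coeff_vec n g" using onto by blast
    then have "poly_act A g v = u" using act_below P_cancel[OF u] by metis
    then show "\<exists>g. poly_act A g v = u" ..
  qed
  moreover have "poly_act A f v = 0\<^sub>v n"
    using P by (simp add: act coeff_vec_0 mult_mat_zero_vec)
  ultimately have pair: "(A, v) \<in> cyclic_pairs n f" by (simp add: cyclic_pairs_def)
  have "krylov_mat n A v = P"
  proof (rule eq_matI_mult_vec[OF _ P])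
    fix u :: "'a Matrix.vec" assume "u \<in> carrier_vec n"
    then obtain g where g: "g \<in> polys_below n" "u = coeff_vec n g" using onto by blast
    then show "krylov_mat n A v *\<^sub>v u = P *\<^sub>v u"
      using krylov_mat_mult_coeff_vec[OF A v g(1)] act_below by simp
  qed (simp add: krylov_mat_def)
  then show ?thesis using pair by force
qed

lemma bij_betw_krylov_mat:
  fixes f :: "'a :: {field, finite} poly"
  assumes "f \<in> monic_polys n"
  shows "bij_betw (\<lambda>(A, v). krylov_mat n A v) (cyclic_pairs n f) (GL_set n)"
  unfolding bij_betw_def
  using krylov_mat_inj[OF assms] krylov_mat_surj[OF assms] krylov_mat_in_GL_set[OF assms] by auto

lemma finite_carrier_mat: "finite (carrier_mat n m :: 'a :: {field, finite} mat set)"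
proof -
  let ?E = "PiE ({..<n} \<times> {..<m}) (\<lambda>_. UNIV :: 'a set)"
  have "carrier_mat n m \<subseteq> Matrix.mat n m ` ?E"
  proof
    fix A :: "'a mat" assume "A \<in> carrier_mat n m"
    then have "A = Matrix.mat n m (restrict (\<lambda>ij. A $$ ij) ({..<n} \<times> {..<m}))"
      by (intro eq_matI) auto
    moreover have "restrict (\<lambda>ij. A $$ ij) ({..<n} \<times> {..<m}) \<in> ?E" by auto
    ultimately show "A \<in> Matrix.mat n m ` ?E" by blast
  qed
  moreover have "finite ?E" by (rule finite_PiE) auto
  ultimately show ?thesis by (meson finite_imageI finite_subset)
qed

lemma GL_order_eq: "GL_order TYPE('a :: {field, finite}) n = card (GL_set n :: 'a mat set)"
  by (simp add: GL_order_def GL_set_def)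

lemma GL_order_pos: "GL_order TYPE('a :: {field, finite}) n > 0"
proof -
  have "(1\<^sub>m n :: 'a mat) \<in> GL_set n" by (rule inj_mult_vec_imp_GL_set) auto
  moreover have "finite (GL_set n :: 'a mat set)"
    by (rule finite_subset[OF _ finite_carrier_mat[of n n]]) (auto simp: GL_set_def)
  ultimately show ?thesis by (auto simp: GL_order_eq card_gt_0_iff)
qed

text \<open>Double counting of \<open>cyclic_pairs n f\<close>: Krylov matrices give the right-hand side, and grouping
  the pairs by their matrix gives the left. In terms of group actions this is orbit and
  stabiliser of the companion matrix under conjugation, the stabiliser being the group of
  units modulo \<open>f\<close>.\<close>

lemma card_cyclic_class:
  fixes f :: "'a :: {field, finite} poly"
  assumes f: "f \<in> monic_polys n"
  shows "card (fst ` cyclic_pairs n f) * num_units_mod f = GL_order TYPE('a) n"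
proof -
  have fin_class: "finite (fst ` cyclic_pairs n f)"
    by (rule finite_subset[OF _ finite_carrier_mat[of n n]])
      (auto simp: cyclic_pairs_def cyclic_vector_def)
  have fin_fibre: "finite {w. (A, w) \<in> cyclic_pairs n f}" for A
    by (rule finite_subset[OF _ finite_carrier_vec[of n]])
      (auto simp: cyclic_pairs_def cyclic_vector_def)
  have "cyclic_pairs n f = (SIGMA A:fst ` cyclic_pairs n f. {w. (A, w) \<in> cyclic_pairs n f})"
    by force
  then have "card (cyclic_pairs n f)
      = card (SIGMA A:fst ` cyclic_pairs n f. {w. (A, w) \<in> cyclic_pairs n f})" by simp
  also have "\<dots> = (\<Sum>A\<in>fst ` cyclic_pairs n f. card {w. (A, w) \<in> cyclic_pairs n f})"
    using fin_class fin_fibre by (simp add: card_SigmaI)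
  also have "\<dots> = (\<Sum>A\<in>fst ` cyclic_pairs n f. num_units_mod f)"
    by (rule sum.cong) (use card_cyclic_pairs_fibre[OF f] in auto)
  finally show ?thesis
    using bij_betw_same_card[OF bij_betw_krylov_mat[OF f]] by (simp add: GL_order_eq)
qed

text \<open>The relation polynomial of a cyclic vector depends on the matrix only, because a relation at one
  cyclic vector holds at all vectors. So the classes for different \<open>f\<close> are disjoint.\<close>

lemma num_cyclic_mat_eq_sum:
  "num_cyclic_mat TYPE('a :: {field, finite}) n
     = (\<Sum>f\<in>(monic_polys n :: 'a poly set). card (fst ` cyclic_pairs n f))"
proof -
  have eq: "{A :: 'a mat. cyclic_mat n A} = (\<Union>f\<in>monic_polys n. fst ` cyclic_pairs n f)"
  proof (intro equalityI subsetI)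
    fix A :: "'a mat" assume "A \<in> {A. cyclic_mat n A}"
    then obtain v where v: "cyclic_vector n A v" by (auto simp: cyclic_mat_iff_cyclic_vector)
    then obtain f where "f \<in> monic_polys n" "poly_act A f v = 0\<^sub>v n"
      using cyclic_vector_relation_exists by blast
    then show "A \<in> (\<Union>f\<in>monic_polys n. fst ` cyclic_pairs n f)"
      using v by (force simp: cyclic_pairs_def)
  qed (auto simp: cyclic_pairs_def cyclic_mat_iff_cyclic_vector)
  have disj: "fst ` cyclic_pairs n f \<inter> fst ` cyclic_pairs n g = {}"
    if fg: "f \<in> monic_polys n" "g \<in> monic_polys n" "f \<noteq> g" for f g :: "'a poly"
  proof (rule ccontr)
    assume "fst ` cyclic_pairs n f \<inter> fst ` cyclic_pairs n g \<noteq> {}"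
    then obtain A v w where Av: "(A, v) \<in> cyclic_pairs n f" and Aw: "(A, w) \<in> cyclic_pairs n g"
      by force
    then have cv: "cyclic_vector n A v" "poly_act A f v = 0\<^sub>v n" by (auto simp: cyclic_pairs_def)
    have "poly_act A g v = 0\<^sub>v n"
      by (rule cyclic_pairs_relation[OF Aw]) (use cyclic_vector_carriers[OF cv(1)] in blast)
    then have "f dvd g" using poly_act_eq_zero_iff[OF cv(1) fg(1) cv(2)] by blast
    then obtain h where h: "g = f * h" by blast
    then have "h \<in> monic_polys (n - n)" using monic_polys_mult_cancel(2) fg by blast
    then show False using h fg(3) by (simp add: monic_polys_0)
  qed
  have "finite (fst ` cyclic_pairs n f)" for f :: "'a poly"
    by (rule finite_subset[OF _ finite_carrier_mat[of n n]])
      (auto simp: cyclic_pairs_def cyclic_vector_def)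
  then show ?thesis
    unfolding num_cyclic_mat_def eq
    by (intro card_UN_disjoint) (use disj finite_monic_polys in auto)
qed

section \<open>The generating function\<close>

lemma fps_geometric_series:
  fixes c :: "'b :: field"
  assumes "d > 0"
  shows "Abs_fps (\<lambda>m. if d dvd m then c ^ m else 0) * (1 - (fps_const c * fps_X) ^ d) = 1"
proof -
  let ?G = "Abs_fps (\<lambda>m. if d dvd m then c ^ m else 0)"
  have "?G * (1 - (fps_const c * fps_X) ^ d) = ?G - fps_const (c ^ d) * (fps_X ^ d * ?G)"
    by (simp add: power_mult_distrib fps_const_power algebra_simps)
  also have "\<dots> = 1"
  proof (rule fps_ext)
    fix m
    show "fps_nth (?G - fps_const (c ^ d) * (fps_X ^ d * ?G)) m = fps_nth 1 m"
    proof (cases "m < d")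
      case True
      then show ?thesis using assms by (auto simp: fps_X_power_mult_nth dest: nat_dvd_not_less)
    next
      case False
      then obtain j where "m = d + j" using le_Suc_ex not_less by blast
      then show ?thesis using assms by (simp add: fps_X_power_mult_nth power_add)
    qed
  qed
  finally show ?thesis .
qed

lemma fps_divide_one_minus_power:
  fixes c :: "'b :: field"
  assumes "d > 0"
  shows "f / (1 - (fps_const c * fps_X) ^ d) = f * Abs_fps (\<lambda>m. if d dvd m then c ^ m else 0)"
proof -
  let ?U = "1 - (fps_const c * fps_X) ^ d" and ?G = "Abs_fps (\<lambda>m. if d dvd m then c ^ m else 0)"
  have G: "?G * ?U = 1" by (rule fps_geometric_series[OF assms])
  then have "?U \<noteq> 0" by (metis mult_zero_right zero_neq_one)
  moreover have "f = f * ?G * ?U" using G by (simp add: mult.assoc)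
  ultimately show ?thesis by (metis nonzero_mult_div_cancel_right)
qed

lemma multiplicative_weight_inverse_num_units:
  "multiplicative_weight (\<lambda>f :: 'a :: {field, finite} poly. 1 / of_nat (num_units_mod f) :: rat)"
proof -
  have "unit_residues (1 :: 'a poly) = {0}"
    by (auto simp: unit_residues_def polys_below_0)
  then have "num_units_mod (1 :: 'a poly) = 1" by (simp add: num_units_mod_def)
  moreover have "num_units_mod (f * g) = num_units_mod f * num_units_mod g"
    if "lead_coeff f = 1" "lead_coeff g = 1" "coprime f g" for f g :: "'a poly"
    using that by (intro num_units_mod_mult) auto
  ultimately show ?thesis by (simp add: multiplicative_weight_def)
qed

text \<open>The units modulo \<open>p\<^bsup>k+1\<^esup>\<close> number \<open>(q\<^sup>d - 1) q\<^bsup>dk\<^esup>\<close>, so the factor is a geometric series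
  apart from its constant term.\<close>

lemma euler_factor_inverse_num_units:
  fixes p :: "'a :: {field, finite} poly"
  assumes p: "p \<in> monic_irreducibles d"
  shows "euler_factor (\<lambda>f. 1 / of_nat (num_units_mod f) :: rat) p
    = 1 + fps_const (1 / (of_nat (CARD('a)) ^ d - 1)) *
            (fps_X ^ d / (1 - (fps_const (1 / of_nat (CARD('a))) * fps_X) ^ d))"
proof -
  let ?w = "\<lambda>f :: 'a poly. 1 / of_nat (num_units_mod f) :: rat"
  define q :: rat where "q = of_nat (CARD('a))"
  have d: "d > 0" by (rule monic_irreducibles_degree_pos[OF p])
  have deg: "degree p = d" and irr: "Factorial_Ring.irreducible p"
    using p by (auto simp: monic_irreducibles_def)
  have w1: "?w 1 = 1"
    using multiplicative_weight_inverse_num_units unfolding multiplicative_weight_def by blast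
  have q: "q > 1" unfolding q_def using card_finite_field_gt_1[where 'a = 'a] by simp
  have w: "?w (p ^ Suc k) = 1 / (q ^ d - 1) * (1 / q) ^ (d * k)" for k
  proof -
    have "of_nat (num_units_mod (p ^ Suc k) + CARD('a) ^ (d * k)) = (of_nat (CARD('a) ^ (d * Suc k)) :: rat)"
      using num_units_mod_prime_power[OF irr, of d k] deg by simp
    then have "of_nat (num_units_mod (p ^ Suc k)) = q ^ (d * Suc k) - q ^ (d * k)"
      unfolding of_nat_add of_nat_power q_def[symmetric] by linarith
    also have "\<dots> = (q ^ d - 1) * q ^ (d * k)" by (simp add: algebra_simps power_add)
    finally show ?thesis by (simp add: power_one_over)
  qed
  have "fps_nth (euler_factor ?w p) m = fps_nth (1 + fps_const (1 / (q ^ d - 1)) *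
      (fps_X ^ d * Abs_fps (\<lambda>m. if d dvd m then (1 / q) ^ m else 0))) m" for m
  proof (cases "m < d")
    case True
    then show ?thesis
      using d w1 by (auto simp: euler_factor_def deg fps_X_power_mult_nth dest: nat_dvd_not_less)
  next
    case False
    then obtain j where m: "m = d + j" using le_Suc_ex not_less by blast
    show ?thesis
    proof (cases "d dvd j")
      case True
      then obtain k where "j = d * k" by blast
      then have "m div d = Suc k" "d dvd m" using d by (simp_all add: m)
      then show ?thesis
        using d w[of k] m \<open>j = d * k\<close> by (simp add: euler_factor_def deg fps_X_power_mult_nth del: power_Suc)
    next
      case False
      then show ?thesis using d m by (simp add: euler_factor_def deg fps_X_power_mult_nth)
    qed
  qed
  then show ?thesis
    unfolding fps_divide_one_minus_power[OF d] q_def[symmetric] by (intro fps_ext)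
qed

lemma multiplicative_weight_degree:
  fixes c :: "'b :: comm_ring_1"
  shows "multiplicative_weight (\<lambda>f :: 'a :: field poly. c ^ degree f)"
  unfolding multiplicative_weight_def
  by (metis degree_1 degree_mult_eq leading_coeff_0_iff power_0 power_add zero_neq_one)

lemma euler_factor_degree:
  fixes c :: "'b :: comm_ring_1"
  assumes p: "p \<in> monic_irreducibles d"
  shows "euler_factor (\<lambda>f. c ^ degree f) p = Abs_fps (\<lambda>m. if d dvd m then c ^ m else 0)"
proof -
  have "degree p = d" "p \<noteq> 0" using p by (auto simp: monic_irreducibles_def)
  then show ?thesis by (auto simp: euler_factor_def fps_eq_iff degree_power_eq mult.commute)
qed

text \<open>There are \<open>q\<^sup>n\<close> monic polynomials of degree \<open>n\<close>, so every coefficient of the series is \<open>1\<close>.\<close>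

lemma weight_series_degree:
  "weight_series (\<lambda>f :: 'a :: {field, finite} poly. (1 / of_nat (CARD('a)) :: rat) ^ degree f) * (1 - fps_X) = 1"
proof -
  have "(\<Sum>f\<in>(monic_polys n :: 'a poly set). (1 / of_nat (CARD('a)) :: rat) ^ degree f) = 1" for n
  proof -
    have "(\<Sum>f\<in>(monic_polys n :: 'a poly set). (1 / of_nat (CARD('a)) :: rat) ^ degree f)
        = (\<Sum>f\<in>(monic_polys n :: 'a poly set). (1 / of_nat (CARD('a))) ^ n)"
      by (rule sum.cong) (auto simp: monic_polys_def)
    then show ?thesis by (simp add: card_monic_polys power_one_over)
  qed
  then show ?thesis
    using fps_geometric_series[of 1 "1 :: rat"] by (simp add: weight_series_def)
qed

lemma cyclic_series_eq_weight_series: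
  "cyclic_series TYPE('a :: {field, finite})
     = weight_series (\<lambda>f :: 'a poly. 1 / of_nat (num_units_mod f))"
proof (rule fps_ext)
  fix n
  have "of_nat (num_cyclic_mat TYPE('a) n) / of_nat (GL_order TYPE('a) n)
      = (\<Sum>f\<in>(monic_polys n :: 'a poly set). 1 / of_nat (num_units_mod f) :: rat)"
  proof -
    have "of_nat (card (fst ` cyclic_pairs n f)) / of_nat (GL_order TYPE('a) n)
        = (1 / of_nat (num_units_mod f) :: rat)" if f: "f \<in> monic_polys n" for f :: "'a poly"
    proof -
      have "num_units_mod f > 0" by (rule num_units_mod_pos[OF monic_polys_nonzero[OF f]])
      moreover have "GL_order TYPE('a) n > 0" by (rule GL_order_pos)
      moreover have "of_nat (card (fst ` cyclic_pairs n f)) * of_nat (num_units_mod f)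
          = (of_nat (GL_order TYPE('a) n) :: rat)"
        using card_cyclic_class[OF f] by (metis of_nat_mult)
      ultimately show ?thesis by (simp add: field_simps)
    qed
    then show ?thesis
      by (simp add: num_cyclic_mat_eq_sum sum_divide_distrib cong: sum.cong)
  qed
  then show "fps_nth (cyclic_series TYPE('a)) n
      = fps_nth (weight_series (\<lambda>f :: 'a poly. 1 / of_nat (num_units_mod f))) n"
    using multiplicative_weight_inverse_num_units[where 'a = 'a]
    by (cases "n = 0")
      (simp_all add: cyclic_series_def weight_series_def monic_polys_0 multiplicative_weight_def)
qed

lemma fps_mult_nth_cong:
  assumes "\<And>i. i \<le> n \<Longrightarrow> fps_nth a i = fps_nth a' i" "\<And>i. i \<le> n \<Longrightarrow> fps_nth b i = fps_nth b' i"
  shows "fps_nth (a * b) n = fps_nth (a' * b') n"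
  unfolding fps_mult_nth by (intro sum.cong refl arg_cong2[of _ _ _ _ "(*)"] assms) auto

theorem theorem17:
  fixes q :: nat
  assumes "CARD('a :: {field, finite}) = q"
  shows
    "(let f = (\<lambda>i.
         (1 + fps_const (1 / (of_nat q ^ Suc i - 1)) *
                (fps_X ^ Suc i / (1 - (fps_const (1 / of_nat q) * fps_X) ^ Suc i)))
            ^ num_monic_irred TYPE('a) (Suc i))
      in convergent_prod f \<and> cyclic_series TYPE('a) = prodinf f) \<and>
     (let g = (\<lambda>i.
         (1 + fps_const (1 / (of_nat q ^ Suc i * (of_nat q ^ Suc i - 1))) * fps_X ^ Suc i)
            ^ num_monic_irred TYPE('a) (Suc i))
      in convergent_prod g \<and> cyclic_series TYPE('a) = 1 / (1 - fps_X) * prodinf g)"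
proof -
  define F :: "nat \<Rightarrow> rat fps" where "F = (\<lambda>i. 1 + fps_const (1 / (of_nat q ^ Suc i - 1)) *
      (fps_X ^ Suc i / (1 - (fps_const (1 / of_nat q) * fps_X) ^ Suc i)))"
  define G :: "nat \<Rightarrow> rat fps" where
    "G = (\<lambda>i. 1 + fps_const (1 / (of_nat q ^ Suc i * (of_nat q ^ Suc i - 1))) * fps_X ^ Suc i)"
  \<comment> \<open>\<open>H i\<close> is \<open>1 / (1 - (u/q)\<^sup>d)\<close> for \<open>d = i + 1\<close>.\<close>
  define H :: "nat \<Rightarrow> rat fps" where
    "H = (\<lambda>i. Abs_fps (\<lambda>m. if Suc i dvd m then (1 / of_nat q) ^ m else 0))"
  define N where "N = (\<lambda>i. num_monic_irred TYPE('a) (Suc i))"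
  define Z where "Z = cyclic_series TYPE('a)"
  have q: "(of_nat q :: rat) > 1" using card_finite_field_gt_1[where 'a = 'a] assms by simp

  have prod_F: "fps_nth (\<Prod>i\<le>D. F i ^ N i) n = fps_nth Z n" if "n \<le> D" for n D
    unfolding Z_def cyclic_series_eq_weight_series N_def
    by (rule euler_product[OF multiplicative_weight_inverse_num_units _ that])
      (simp only: F_def euler_factor_inverse_num_units assms)
  have prod_H: "fps_nth ((\<Prod>i\<le>D. H i ^ N i) * (1 - fps_X)) n = fps_nth 1 n" if "n \<le> D" for n D
  proof -
    let ?w = "\<lambda>f :: 'a poly. (1 / of_nat (CARD('a)) :: rat) ^ degree f"
    have "fps_nth (\<Prod>i\<le>D. H i ^ N i) k = fps_nth (weight_series ?w) k" if "k \<le> D" for k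
      unfolding N_def
      by (rule euler_product[OF multiplicative_weight_degree _ that])
        (simp only: H_def euler_factor_degree assms)
    then have "fps_nth ((\<Prod>i\<le>D. H i ^ N i) * (1 - fps_X)) n
        = fps_nth (weight_series ?w * (1 - fps_X)) n"
      by (intro fps_mult_nth_cong) (use that in simp_all)
    then show ?thesis by (simp only: weight_series_degree)
  qed
  have GH: "G i * H i = F i" for i
  proof -
    let ?d = "Suc i" and ?Q = "of_nat q ^ Suc i :: rat"
    have "?Q > 1" using q by (simp only: one_less_power zero_less_Suc)
    moreover have "1 / (x * (x - 1)) = 1 / (x - 1) - 1 / x" if "x > 1" for x :: rat
      using that by (simp add: divide_simps)
    ultimately have c: "1 / (?Q * (?Q - 1)) = 1 / (?Q - 1) - (1 / of_nat q) ^ ?d"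
      unfolding power_one_over by blast
    have "H i * (1 - (fps_const (1 / of_nat q) * fps_X) ^ ?d) = 1"
      unfolding H_def by (rule fps_geometric_series) simp
    then have "H i * (1 - fps_const ((1 / of_nat q) ^ ?d) * fps_X ^ ?d) = 1"
      by (simp only: power_mult_distrib fps_const_power)
    then have "H i - H i * fps_const ((1 / of_nat q) ^ ?d) * fps_X ^ ?d = 1"
      by (simp only: right_diff_distrib mult.assoc mult_1_right)
    moreover have "F i = 1 + fps_const (1 / (?Q - 1)) * (fps_X ^ ?d * H i)"
      unfolding F_def H_def by (subst fps_divide_one_minus_power) simp_all
    moreover have "G i = 1 + (fps_const (1 / (?Q - 1)) - fps_const ((1 / of_nat q) ^ ?d)) * fps_X ^ ?d"
      unfolding G_def c by (simp only: fps_const_sub)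
    moreover have "(1 + (a - b) * x) * h = f" if "h - h * b * x = 1" "f = 1 + a * (x * h)"
      for a b f h x :: "rat fps"
    proof -
      have "(1 + (a - b) * x) * h = (h - h * b * x) + a * (x * h)" by (simp add: algebra_simps)
      then show ?thesis using that by simp
    qed
    ultimately show ?thesis by metis
  qed

  \<comment> \<open>Up to degree \<open>D\<close> the inserted factor \<open>(\<Prod>i\<le>D. H i ^ N i) * (1 - u)\<close> is \<open>1\<close>; absorbing its first
    part turns the \<open>G i\<close> into the \<open>F i\<close>.\<close>
  have prod_G: "fps_nth (\<Prod>i\<le>D. G i ^ N i) n = fps_nth (Z * (1 - fps_X)) n" if "n \<le> D" for n D
  proof -
    have "fps_nth ((\<Prod>i\<le>D. G i ^ N i) * 1) n
        = fps_nth ((\<Prod>i\<le>D. G i ^ N i) * ((\<Prod>i\<le>D. H i ^ N i) * (1 - fps_X))) n"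
      by (rule fps_mult_nth_cong) (use prod_H that in simp_all)
    also have "(\<Prod>i\<le>D. G i ^ N i) * ((\<Prod>i\<le>D. H i ^ N i) * (1 - fps_X))
        = (\<Prod>i\<le>D. F i ^ N i) * (1 - fps_X)"
      by (simp only: GH[symmetric] power_mult_distrib prod.distrib mult.assoc)
    also have "fps_nth \<dots> n = fps_nth (Z * (1 - fps_X)) n"
      by (rule fps_mult_nth_cong) (use prod_F that in simp_all)
    finally show ?thesis by simp
  qed

  have Z0: "fps_nth Z 0 = 1" by (simp add: Z_def cyclic_series_def)
  then have "Z \<noteq> 0" by auto
  have F_prod: "convergent_prod (\<lambda>i. F i ^ N i)" "prodinf (\<lambda>i. F i ^ N i) = Z"
    using prod_F \<open>Z \<noteq> 0\<close> by (auto intro!: convergent_prod_fps)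
  have "Z * (1 - fps_X) \<noteq> 0" using Z0 by (metis fps_X_neq_one mult_eq_0_iff \<open>Z \<noteq> 0\<close> eq_iff_diff_eq_0)
  then have G_prod: "convergent_prod (\<lambda>i. G i ^ N i)" "prodinf (\<lambda>i. G i ^ N i) = Z * (1 - fps_X)"
    using prod_G by (auto intro!: convergent_prod_fps)
  have "1 / (1 - fps_X) * (Z * (1 - fps_X)) = Z"
    using fps_divide_one_minus_power[of 1 1 "1 :: rat"] fps_geometric_series[of 1 "1 :: rat"]
    by (simp add: mult_ac)
  then show ?thesis
    using F_prod G_prod unfolding Let_def F_def G_def N_def Z_def by simp
qed

end
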